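(* Let $\lambda_1,\dots,\lambda_n>0$, $\mu_1>\cdots>\mu_n>0$ and $v_1,\dots,v_n$ be given, and suppose that for all $i,j$: if $\mathbb E[S_i]\ge\mathbb E[S_j]$ then $\frac{\mathbb E[S_i^2]}{\mathbb E[S_i]}\ge\frac{\mathbb E[S_j^2]}{\mathbb E[S_j]}$. If the feasible set of the multi-queue partition problem $$(k\text{-QPP})\qquad\inf_{X,\boldsymbol\alpha}f(X,\boldsymbol\alpha)\quad\text{s.t. }(X,\boldsymbol\alpha)\in\mathcal F,\ \sum_{j=1}^k\alpha_j=1,\ \alpha_j\ge0,\ \sum_{j=1}^kX_{ij}=1,\ X_{ij}\in[0,1]\ (\text{all }i,j)$$ is non-empty, then there exist an optimal solution $(X^*,\boldsymbol\alpha^* )$ of $k$-QPP and integers $1=i_0\le i_1\le\cdots\le i_{k-1}\le i_k=n+1$ such that, for all $i\in\{1,\dots,n\}$ and $j\in\{1,\dots,k\}$, $$X^*_{ij}=\begin{cases}1&\text{if }i_{j-1}\le i<i_j,\\0&\text{otherwise.}\end{cases}$$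
   Context: There are $n$ customer types and $k$ queues. Type $i$ arrives as a Poisson process with rate $\lambda_i$ and has a service time $S_i$ (nonnegative random variable, under a unit-capacity server) with $\mathbb E[S_i]=1/\mu_i$, $\mathbb E[S_i^2]=v_i<\infty$. $\alpha_j$ is the capacity of queue $j$, $R(\boldsymbol\alpha)=\{j:\alpha_j>0\}$, and $X_{ij}$ is the probability that a type $i$ customer is assigned to queue $j$. The expected waiting time is $$f(X,\boldsymbol\alpha)=\sum_{j\in R(\boldsymbol\alpha)}\left(\frac{\sum_{i}\lambda_iX_{ij}v_i}{\alpha_j^2-\alpha_j\sum_{i}\frac{\lambda_iX_{ij}}{\mu_i}}\cdot\frac{\sum_{i}X_{ij}\lambda_i}{2\sum_{i}\lambda_i}\right),$$ and $\mathcal F$ is the set of $(X,\boldsymbol\alpha)$ with $\alpha_j>\sum_i\lambda_iX_{ij}/\mu_i$ for all $j\in R(\boldsymbol\alpha)$ and $X_{ij}=0$ for all $i$ and all $j\notin R(\boldsymbol\alpha)$. *)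

theory Defs
  imports "HOL-Probability.Probability"
begin

text \<open>
  Customer types are indexed by \<open>{1..n}\<close> and queues by \<open>{1..k}\<close>. An assignment \<open>X\<close> and a capacity
  vector \<open>\<alpha>\<close> are total functions on \<open>nat\<close>; no definition reads their values outside these ranges.
\<close>

definition active_queues :: "nat \<Rightarrow> (nat \<Rightarrow> real) \<Rightarrow> nat set" where
  "active_queues k \<alpha> = {j \<in> {1..k}. \<alpha> j > 0}"

definition expected_wait ::
    "nat \<Rightarrow> nat \<Rightarrow> (nat \<Rightarrow> real) \<Rightarrow> (nat \<Rightarrow> real) \<Rightarrow> (nat \<Rightarrow> real)
      \<Rightarrow> (nat \<Rightarrow> nat \<Rightarrow> real) \<times> (nat \<Rightarrow> real) \<Rightarrow> real" where
  "expected_wait n k lam \<mu> v = (\<lambda>(X, \<alpha>).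
     \<Sum>j\<in>active_queues k \<alpha>.
       ((\<Sum>i=1..n. lam i * X i j * v i)
          / ((\<alpha> j)\<^sup>2 - \<alpha> j * (\<Sum>i=1..n. lam i * X i j / \<mu> i)))
       * ((\<Sum>i=1..n. X i j * lam i) / (2 * (\<Sum>i=1..n. lam i))))"

definition stable_set ::
    "nat \<Rightarrow> nat \<Rightarrow> (nat \<Rightarrow> real) \<Rightarrow> (nat \<Rightarrow> real)
      \<Rightarrow> ((nat \<Rightarrow> nat \<Rightarrow> real) \<times> (nat \<Rightarrow> real)) set" where
  "stable_set n k lam \<mu> = {(X, \<alpha>).
     (\<forall>j\<in>active_queues k \<alpha>. \<alpha> j > (\<Sum>i=1..n. lam i * X i j / \<mu> i)) \<and>
     (\<forall>i\<in>{1..n}. \<forall>j\<in>{1..k} - active_queues k \<alpha>. X i j = 0)}"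

definition qpp_feasible ::
    "nat \<Rightarrow> nat \<Rightarrow> (nat \<Rightarrow> real) \<Rightarrow> (nat \<Rightarrow> real)
      \<Rightarrow> ((nat \<Rightarrow> nat \<Rightarrow> real) \<times> (nat \<Rightarrow> real)) set" where
  "qpp_feasible n k lam \<mu> = {(X, \<alpha>).
     (X, \<alpha>) \<in> stable_set n k lam \<mu> \<and>
     (\<Sum>j=1..k. \<alpha> j) = 1 \<and>
     (\<forall>j\<in>{1..k}. \<alpha> j \<ge> 0) \<and>
     (\<forall>i\<in>{1..n}. (\<Sum>j=1..k. X i j) = 1) \<and>
     (\<forall>i\<in>{1..n}. \<forall>j\<in>{1..k}. X i j \<in> {0..1})}"

definition qpp_optimal ::
    "nat \<Rightarrow> nat \<Rightarrow> (nat \<Rightarrow> real) \<Rightarrow> (nat \<Rightarrow> real) \<Rightarrow> (nat \<Rightarrow> real)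
      \<Rightarrow> (nat \<Rightarrow> nat \<Rightarrow> real) \<times> (nat \<Rightarrow> real) \<Rightarrow> bool" where
  "qpp_optimal n k lam \<mu> v =
     is_arg_min (expected_wait n k lam \<mu> v) (\<lambda>p. p \<in> qpp_feasible n k lam \<mu>)"

end

theory Submission
  imports Defs
begin

text \<open>
  Write the cost of a queue as \<open>M * L / (s * a)\<close>, where \<open>M\<close> and \<open>L\<close> are its second-moment rate and
  its arrival rate, \<open>a\<close> is its capacity, \<open>p\<close> its load and \<open>s = a - p\<close> its slack. An optimum exists
  by compactness. At an optimum, compare two queues that both serve customers. If both \<open>M\<close> and
  \<open>L\<close> are more expensive at the margin in the same queue, then either moving any one of its types
  away is an improvement to first order, or pooling the two queues is an improvement. Otherwise one
  queue has the costlier \<open>M\<close> and the other one the costlier \<open>L\<close>. Per unit of load, long types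
  contribute more to \<open>M\<close> and short types more to \<open>L\<close>, so exchanging equal loads of an inverted pair
  of types does not hurt to first order and helps to second order. Finally, if one type is split between
  the two queues, move it together with an amount of slack that keeps both costs stationary to first
  order: both are concave along this direction, strictly unless the queues serve this type only, and
  in that case pooling helps. Hence the sets of types of any two queues are separated, and it remains
  to number the queues in increasing order of their types.
\<close>

subsection \<open>Second-order expansion of the cost of a queue\<close>

text \<open>
  A queue with second-moment rate \<open>M\<close>, arrival rate \<open>L\<close>, slack \<open>s\<close> and capacity \<open>a\<close> costs
  \<open>M * L / (s * a)\<close>. When these four quantities grow at relative speeds \<open>x\<close>, \<open>y\<close>, \<open>z\<close>, \<open>w\<close>,
  the cost is multiplied by \<open>ratio x y z w t\<close>, whose second-order Taylor expansion at \<open>t = 0\<close> is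
  \<open>1 + slope * t + curvature * t\<^sup>2\<close>.
\<close>

definition ratio :: "real \<Rightarrow> real \<Rightarrow> real \<Rightarrow> real \<Rightarrow> real \<Rightarrow> real" where
  "ratio x y z w t = (1 + t * x) * (1 + t * y) / ((1 + t * z) * (1 + t * w))"

definition slope :: "real \<Rightarrow> real \<Rightarrow> real \<Rightarrow> real \<Rightarrow> real" where
  "slope x y z w = x + y - z - w"

definition curvature :: "real \<Rightarrow> real \<Rightarrow> real \<Rightarrow> real \<Rightarrow> real" where
  "curvature x y z w = x * y - z * w - slope x y z w * (z + w)"

lemma slope_uminus: "slope (- x) (- y) (- z) (- w) = - slope x y z w"
  by (simp add: slope_def)

lemma curvature_uminus: "curvature (- x) (- y) (- z) (- w) = curvature x y z w"
  by (simp add: curvature_def slope_uminus algebra_simps)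

text \<open>This is \<open>(ratio - 1 - slope * t) / t\<^sup>2\<close> with the division by
  \<open>t\<^sup>2\<close> carried out, so that its limit at 0 is found by substitution.\<close>

definition ratio_remainder :: "real \<Rightarrow> real \<Rightarrow> real \<Rightarrow> real \<Rightarrow> real \<Rightarrow> real" where
  "ratio_remainder x y z w t =
     (curvature x y z w - t * (slope x y z w * z * w)) / ((1 + t * z) * (1 + t * w))"

lemma quotient_of_products:
  "(a * x) * (b * y) / ((c * z) * (d * w)) = a * b / (c * d) * (x * y / (z * w))"
  for a b c d x y z w :: real
  by (simp add: mult_ac)

lemma ratio_scale:
  assumes "m \<noteq> 0" "a \<noteq> 0" "s \<noteq> 0" "c \<noteq> 0"
  shows "(m + t * x) * (a + t * y) / ((s + t * z) * (c + t * w))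
    = m * a / (s * c) * ratio (x / m) (y / a) (z / s) (w / c) t"
proof -
  have *: "u + t * u' = u * (1 + t * (u' / u))" if "u \<noteq> 0" for u u' :: real
    using that by (simp add: algebra_simps)
  show ?thesis
    unfolding ratio_def *[OF assms(1)] *[OF assms(2)] *[OF assms(3)] *[OF assms(4)]
    by (rule quotient_of_products)
qed

lemma ratio_expansion:
  assumes "1 + t * z \<noteq> 0" "1 + t * w \<noteq> 0"
  shows "ratio x y z w t = 1 + t * (slope x y z w + t * ratio_remainder x y z w t)"
  using assms unfolding ratio_def ratio_remainder_def curvature_def slope_def
  by (simp add: divide_simps) (simp add: algebra_simps)

lemma ratio_remainder_tendsto:
  "(ratio_remainder x y z w \<longlongrightarrow> curvature x y z w) (at_right 0)"
  unfolding ratio_remainder_def by (auto intro!: tendsto_eq_intros)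

lemma eventually_affine_pos:
  assumes "c > 0"
  shows "eventually (\<lambda>t. c + t * z > (0::real)) (at_right 0)"
proof -
  have "((\<lambda>t. c + t * z) \<longlongrightarrow> c) (at_right 0)"
    by (auto intro!: tendsto_eq_intros)
  then show ?thesis
    by (rule order_tendstoD) (use assms in auto)
qed

lemma eventually_affine_nonneg:
  assumes "c \<ge> 0" "z < 0 \<Longrightarrow> c > 0"
  shows "eventually (\<lambda>t. 0 \<le> c + t * (z::real)) (at_right 0)"
proof (cases "z < 0")
  case True
  from eventually_affine_pos[OF assms(2)[OF this]] show ?thesis
    by (rule eventually_mono) (rule less_imp_le)
next
  case False
  from eventually_at_right_less[of 0] show ?thesis
    by (rule eventually_mono) (use False assms in simp)
qed

text \<open>Divide the expanded inequality by \<open>t > 0\<close> and let \<open>t\<close> tend to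
  0; if the slopes cancel, divide once more. Limits from the right suffice, because a move need only
  be feasible forwards.\<close>

lemma optimality_conditions:
  fixes f1 f2 :: real
  assumes opt: "eventually (\<lambda>t. f1 + f2 \<le> f1 * ratio x1 y1 z1 w1 t + f2 * ratio x2 y2 z2 w2 t)
                  (at_right 0)"
  shows first_order: "0 \<le> f1 * slope x1 y1 z1 w1 + f2 * slope x2 y2 z2 w2"
    and second_order: "f1 * slope x1 y1 z1 w1 + f2 * slope x2 y2 z2 w2 = 0 \<Longrightarrow>
      0 \<le> f1 * curvature x1 y1 z1 w1 + f2 * curvature x2 y2 z2 w2"
proof -
  define E where "E = f1 * slope x1 y1 z1 w1 + f2 * slope x2 y2 z2 w2"
  define R where "R = (\<lambda>t. f1 * ratio_remainder x1 y1 z1 w1 t + f2 * ratio_remainder x2 y2 z2 w2 t)"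
  have ev: "eventually (\<lambda>t. 0 \<le> E + t * R t) (at_right 0)"
    using opt eventually_affine_pos[OF zero_less_one, of z1] eventually_affine_pos[OF zero_less_one, of w1]
      eventually_affine_pos[OF zero_less_one, of z2] eventually_affine_pos[OF zero_less_one, of w2]
      eventually_at_right_less[of 0]
  proof eventually_elim
    case (elim t)
    have "f1 + f2 \<le> f1 * (1 + t * (slope x1 y1 z1 w1 + t * ratio_remainder x1 y1 z1 w1 t))
        + f2 * (1 + t * (slope x2 y2 z2 w2 + t * ratio_remainder x2 y2 z2 w2 t))"
      using elim ratio_expansion[of t z1 w1 x1 y1] ratio_expansion[of t z2 w2 x2 y2] by simp
    then have "0 \<le> t * (E + t * R t)"
      unfolding E_def R_def by (simp add: algebra_simps)
    with elim show ?case by (simp add: zero_le_mult_iff)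
  qed
  have limR: "(R \<longlongrightarrow> f1 * curvature x1 y1 z1 w1 + f2 * curvature x2 y2 z2 w2) (at_right 0)"
    unfolding R_def by (intro tendsto_intros ratio_remainder_tendsto)
  have "((\<lambda>t. E + t * R t) \<longlongrightarrow> E) (at_right 0)"
    using limR by (auto intro!: tendsto_eq_intros)
  from tendsto_lowerbound[OF this ev] show "0 \<le> f1 * slope x1 y1 z1 w1 + f2 * slope x2 y2 z2 w2"
    by (simp add: E_def)
  assume "f1 * slope x1 y1 z1 w1 + f2 * slope x2 y2 z2 w2 = 0"
  then have "E = 0" by (simp add: E_def)
  have "eventually (\<lambda>t. 0 \<le> R t) (at_right 0)"
    using ev eventually_at_right_less[of 0]
    by eventually_elim (simp add: \<open>E = 0\<close> zero_le_mult_iff)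
  from tendsto_lowerbound[OF limR this]
  show "0 \<le> f1 * curvature x1 y1 z1 w1 + f2 * curvature x2 y2 z2 w2" by simp
qed

section \<open>Inequalities in favour of pooling two queues\<close>

text \<open>Up to a common factor, only the ratios of queue 1 to queue 2 matter. In these ratios the
  claim is \<open>key\<close> and the hypotheses are the four inequalities \<open>b\<close>; they
  imply that \<open>s\<close> exceeds each of \<open>a\<close>, \<open>A\<close> and
  \<open>L\<close>.\<close>

lemma pooling_improves:
  fixes A1 A2 L1 L2 s1 s2 a1 a2 :: real
  assumes pos: "A1 > 0" "A2 > 0" "L1 > 0" "L2 > 0" "s1 > 0" "s2 > 0" "a1 > 0" "a2 > 0"
    and L: "L2 / (s2 * a2) < L1 / (s1 * a1)"
    and A: "A2 / (s2 * a2) < A1 / (s1 * a1)"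
    and s: "A1 * L1 / (s1 * a1) / s1 < A2 * L2 / (s2 * a2) / s2"
    and a: "A2 * L2 / (s2 * a2) / a2 < A1 * L1 / (s1 * a1) / a1"
  shows "(A1 + A2) * (L1 + L2) / ((s1 + s2) * (a1 + a2))
    < A1 * L1 / (s1 * a1) + A2 * L2 / (s2 * a2)"
proof -
  obtain A where A1: "A1 = A * A2" using pos by (metis nonzero_eq_divide_eq less_irrefl)
  obtain L where L1: "L1 = L * L2" using pos by (metis nonzero_eq_divide_eq less_irrefl)
  obtain s where s1: "s1 = s * s2" using pos by (metis nonzero_eq_divide_eq less_irrefl)
  obtain a where a1: "a1 = a * a2" using pos by (metis nonzero_eq_divide_eq less_irrefl)
  have p: "A > 0" "L > 0" "s > 0" "a > 0"
    using pos unfolding A1 L1 s1 a1 by (auto simp: zero_less_mult_iff)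
  have "L > s * a" "A > s * a"
    using L A pos p unfolding A1 L1 s1 a1 by (simp_all add: field_simps)
  moreover have "A * L < s * s * a"
    using s pos p unfolding A1 L1 s1 a1 by (simp add: field_simps)
  moreover have "A * L > s * a * a"
    using a pos p unfolding A1 L1 s1 a1 by (simp add: field_simps)
  ultimately have b: "L > s * a" "A > s * a" "A * L < s * s * a" "A * L > s * a * a" by auto
  have "s * a * a < s * s * a" using b by linarith
  then have "a < s" using p by simp
  have "L < s"
  proof (rule ccontr)
    assume "\<not> L < s"
    then have "s * (s * a) \<le> L * A" using b p by (intro mult_mono) auto
    then show False using b by (simp add: algebra_simps)
  qed
  have "A < s"
  proof (rule ccontr)
    assume "\<not> A < s"
    then have "s * (s * a) \<le> A * L" using b p by (intro mult_mono) auto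
    then show False using b by (simp add: algebra_simps)
  qed
  \<comment> \<open>If \<open>A\<close> or \<open>L\<close> is at most \<open>a\<close>, compare it
    with \<open>a\<close> and the other one with \<open>s\<close>. Otherwise
    \<open>A * L / a\<close> bounds both \<open>A\<close> and \<open>L\<close>, so
    \<open>A + L < s + A * L / a\<close>, and both sides are expanded.\<close>
  have key: "(1 + A) * (1 + L) < (1 + s) * (1 + a) * (1 + A * L / (s * a))"
  proof (cases "A \<le> a \<or> L \<le> a")
    case True
    then have "(1 + A) * (1 + L) < (1 + s) * (1 + a)"
    proof
      assume "A \<le> a"
      then have "(1 + A) * (1 + L) \<le> (1 + a) * (1 + L)" using p by simp
      also have "\<dots> < (1 + a) * (1 + s)" using \<open>L < s\<close> p by simp
      finally show ?thesis by (simp add: mult.commute)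
    next
      assume "L \<le> a"
      then have "(1 + A) * (1 + L) \<le> (1 + A) * (1 + a)" using p by simp
      also have "\<dots> < (1 + s) * (1 + a)" using \<open>A < s\<close> p by simp
      finally show ?thesis .
    qed
    also have "\<dots> \<le> (1 + s) * (1 + a) * (1 + A * L / (s * a))" using p by simp
    finally show ?thesis .
  next
    case False
    have "A \<le> A * L / a" "L \<le> A * L / a" using False p by (simp_all add: field_simps)
    then have "A + L < s + A * L / a" using \<open>A < s\<close> \<open>L < s\<close> by linarith
    moreover have "0 < A * L / s" "0 < A * L / (s * a)" "0 < s * a" using p by simp_all
    moreover have "(1 + s) * (1 + a) * (1 + A * L / (s * a))
        = 1 + s + a + s * a + A * L / (s * a) + A * L / a + A * L / s + A * L"
      using p by (simp add: field_simps)
    moreover have "(1 + A) * (1 + L) = 1 + A + L + A * L" by (simp add: algebra_simps)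
    ultimately show ?thesis using p by linarith
  qed
  have D: "0 < (1 + s) * (1 + a)" "0 < A2 * L2 / (s2 * a2)" using p pos by simp_all
  have "(A1 + A2) * (L1 + L2) / ((s1 + s2) * (a1 + a2))
      = (A2 * L2 / (s2 * a2)) * ((1 + A) * (1 + L) / ((1 + s) * (1 + a)))"
  proof -
    have "A1 + A2 = A2 * (1 + A)" "L1 + L2 = L2 * (1 + L)" "s1 + s2 = s2 * (1 + s)" "a1 + a2 = a2 * (1 + a)"
      unfolding A1 L1 s1 a1 by (simp_all add: algebra_simps)
    then show ?thesis by (simp only: quotient_of_products)
  qed
  also have "\<dots> < (A2 * L2 / (s2 * a2)) * (1 + A * L / (s * a))"
    using key D by (intro mult_strict_left_mono) (simp_all add: pos_divide_less_eq mult.commute)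
  also have "\<dots> = A1 * L1 / (s1 * a1) + A2 * L2 / (s2 * a2)"
    using p pos unfolding A1 L1 s1 a1 by (simp add: field_simps)
  finally show ?thesis .
qed

text \<open>The cost is proportional to \<open>p\<^sup>2 / (s * (s + p))\<close>. By the mediant
  inequality, the queue with the larger ratio of load to slack costs on its own at least as much as
  the pooled queue, and the cost of the other queue is saved.\<close>

lemma pooling_improves_single_type:
  fixes r m p1 p2 s1 s2 :: real
  assumes pos: "r > 0" "m > 0" "p1 > 0" "p2 > 0" "s1 > 0" "s2 > 0"
  shows "(r * p1 + r * p2) * (m * p1 + m * p2) / ((s1 + s2) * (s1 + p1 + (s2 + p2)))
    < (r * p1) * (m * p1) / (s1 * (s1 + p1)) + (r * p2) * (m * p2) / (s2 * (s2 + p2))"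
proof -
  have dominated: "(P + Q) * (P + Q) / ((S + T) * (S + P + (T + Q))) \<le> P * P / (S * (S + P))"
    if "S * Q \<le> T * P" "P > 0" "Q > 0" "S > 0" "T > 0" for P Q S T :: real
  proof -
    have "(P + Q) / (S + T) \<le> P / S" "(P + Q) / (S + P + (T + Q)) \<le> P / (S + P)"
      using that by (simp_all add: field_simps)
    then have "(P + Q) / (S + T) * ((P + Q) / (S + P + (T + Q))) \<le> P / S * (P / (S + P))"
      using that by (intro mult_mono) simp_all
    then show ?thesis by simp
  qed
  have "(p1 + p2) * (p1 + p2) / ((s1 + s2) * (s1 + p1 + (s2 + p2)))
    < p1 * p1 / (s1 * (s1 + p1)) + p2 * p2 / (s2 * (s2 + p2))"
  proof (cases "s1 * p2 \<le> s2 * p1")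
    case True
    have "0 < p2 * p2 / (s2 * (s2 + p2))" using pos by simp
    with dominated[OF True] pos show ?thesis by linarith
  next
    case False
    then have "(p2 + p1) * (p2 + p1) / ((s2 + s1) * (s2 + p2 + (s1 + p1))) \<le> p2 * p2 / (s2 * (s2 + p2))"
      using pos by (intro dominated) simp_all
    moreover have "0 < p1 * p1 / (s1 * (s1 + p1))" using pos by simp
    ultimately show ?thesis by (simp add: add_ac)
  qed
  then have "r * m * ((p1 + p2) * (p1 + p2) / ((s1 + s2) * (s1 + p1 + (s2 + p2))))
    < r * m * (p1 * p1 / (s1 * (s1 + p1)) + p2 * p2 / (s2 * (s2 + p2)))"
    using pos by (intro mult_strict_left_mono) simp_all
  then show ?thesis by (simp add: algebra_simps)
qed

text \<open>
  A type is moved into a queue of load \<open>p\<close> and slack \<open>s\<close>, together with \<open>\<sigma>\<close> units of slack per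
  unit of load, so that the cost is stationary to first order; then the curvature is
  \<open>x * y - z * w\<close>. The hypothesis \<open>ext\<close>: \<open>x - 1 / p\<close> and \<open>y - 1 / p\<close> have opposite signs because the moved type
  is extremal within the queue.
\<close>

lemma split_curvature:
  fixes x y \<sigma> s p :: real
  assumes pos: "s > 0" "p > 0"
    and stationary: "slope x y (\<sigma> / s) ((1 + \<sigma>) / (s + p)) = 0"
    and ext: "(x - 1 / p) * (y - 1 / p) \<le> 0"
  shows "curvature x y (\<sigma> / s) ((1 + \<sigma>) / (s + p)) \<le> 0"
    and "curvature x y (\<sigma> / s) ((1 + \<sigma>) / (s + p)) = 0 \<Longrightarrow> x = 1 / p \<and> y = 1 / p"
proof -
  define z w X Y where "z = \<sigma> / s" and "w = (1 + \<sigma>) / (s + p)" and "X = x - 1 / p" and "Y = y - 1 / p"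
  have sum: "x + y = z + w" and curv: "curvature x y z w = x * y - z * w"
    using stationary by (simp_all add: slope_def curvature_def z_def w_def)
  \<comment> \<open>\<open>X\<close> and \<open>Y\<close> are the deviations from growth in
    proportion to the load. Capacity is slack plus load, which makes \<open>z - w\<close> the
    multiple \<open>q\<close> of \<open>X + Y\<close>; since \<open>q < 1\<close>, the curvature
    retains a negative square.\<close>
  define q where "q = p / (2 * s + p)"
  have q: "0 < q" "q < 1" using pos by (simp_all add: q_def)
  have "w * (s + p) = 1 + z * s" using pos by (simp add: z_def w_def field_simps)
  moreover have "x + y = X + Y + 2 / p" by (simp add: X_def Y_def)
  ultimately have zw: "z - w = q * (X + Y)"
    using sum pos unfolding q_def by (simp add: field_simps)
  have "4 * (x * y - z * w) = (z - w)\<^sup>2 - (x - y)\<^sup>2"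
    using sum by algebra
  also have "\<dots> = q\<^sup>2 * (X + Y)\<^sup>2 - (X - Y)\<^sup>2"
    unfolding zw by (simp add: X_def Y_def power_mult_distrib)
  also have "\<dots> = 4 * (X * Y) - (1 - q\<^sup>2) * (X + Y)\<^sup>2"
    by (simp add: power2_eq_square algebra_simps)
  finally have c: "4 * curvature x y z w = 4 * (X * Y) - (1 - q\<^sup>2) * (X + Y)\<^sup>2"
    by (simp add: curv)
  have q2: "1 - q\<^sup>2 > 0" using q by (simp add: power_less_one_iff abs_square_less_1)
  then have nn: "0 \<le> (1 - q\<^sup>2) * (X + Y)\<^sup>2" by simp
  with c ext show "curvature x y (\<sigma> / s) ((1 + \<sigma>) / (s + p)) \<le> 0"
    unfolding z_def[symmetric] w_def[symmetric] X_def[symmetric] Y_def[symmetric] by linarith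
  assume "curvature x y (\<sigma> / s) ((1 + \<sigma>) / (s + p)) = 0"
  then have "(1 - q\<^sup>2) * (X + Y)\<^sup>2 = 0" "X * Y = 0"
    using c nn ext unfolding z_def[symmetric] w_def[symmetric] X_def[symmetric] Y_def[symmetric]
    by linarith+
  with q2 have "X + Y = 0" "X * Y = 0" by auto
  then have "X = 0 \<and> Y = 0" by (auto simp: add_eq_0_iff)
  then show "x = 1 / p \<and> y = 1 / p" by (simp add: X_def Y_def)
qed

subsection \<open>The cost of a pair of queues at an optimum\<close>

text \<open>The mean is \<open>1 / \<mu> i\<close>, so \<open>v i * \<mu> i\<close> is the ratio of
  the second to the first moment. Larger indices stand for longer services.\<close>

locale partition_problem =
  fixes n k :: nat and lam \<mu> v :: "nat \<Rightarrow> real"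
  assumes lam_pos: "i \<in> {1..n} \<Longrightarrow> lam i > 0"
    and mu_pos: "i \<in> {1..n} \<Longrightarrow> \<mu> i > 0"
    and mu_decreasing: "\<lbrakk>i \<in> {1..n}; j \<in> {1..n}; i < j\<rbrakk> \<Longrightarrow> \<mu> i > \<mu> j"
    and v_pos: "i \<in> {1..n} \<Longrightarrow> v i > 0"
    and moment_ratio_mono:
      "\<lbrakk>i \<in> {1..n}; j \<in> {1..n}; i \<le> j\<rbrakk> \<Longrightarrow> v i * \<mu> i \<le> v j * \<mu> j"
begin

definition load :: "(nat \<Rightarrow> nat \<Rightarrow> real) \<Rightarrow> nat \<Rightarrow> real" where
  "load X j = (\<Sum>i=1..n. lam i * X i j / \<mu> i)"

definition arrivals :: "(nat \<Rightarrow> nat \<Rightarrow> real) \<Rightarrow> nat \<Rightarrow> real" where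
  "arrivals X j = (\<Sum>i=1..n. X i j * lam i)"

definition moment :: "(nat \<Rightarrow> nat \<Rightarrow> real) \<Rightarrow> nat \<Rightarrow> real" where
  "moment X j = (\<Sum>i=1..n. lam i * X i j * v i)"

definition slack :: "(nat \<Rightarrow> nat \<Rightarrow> real) \<Rightarrow> (nat \<Rightarrow> real) \<Rightarrow> nat \<Rightarrow> real" where
  "slack X \<alpha> j = \<alpha> j - load X j"

text \<open>The factor common to all queues, the reciprocal of twice the total arrival rate, is left
  out. A queue of capacity 0 costs 0 because division by 0 yields 0.\<close>

definition cost :: "(nat \<Rightarrow> nat \<Rightarrow> real) \<Rightarrow> (nat \<Rightarrow> real) \<Rightarrow> nat \<Rightarrow> real" where
  "cost X \<alpha> j = moment X j * arrivals X j / (slack X \<alpha> j * \<alpha> j)"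

definition total_cost :: "(nat \<Rightarrow> nat \<Rightarrow> real) \<Rightarrow> (nat \<Rightarrow> real) \<Rightarrow> real" where
  "total_cost X \<alpha> = (\<Sum>j=1..k. cost X \<alpha> j)"

definition types :: "(nat \<Rightarrow> nat \<Rightarrow> real) \<Rightarrow> nat \<Rightarrow> nat set" where
  "types X j = {i \<in> {1..n}. X i j > 0}"

definition stable :: "(nat \<Rightarrow> nat \<Rightarrow> real) \<Rightarrow> (nat \<Rightarrow> real) \<Rightarrow> nat \<Rightarrow> bool" where
  "stable X \<alpha> j \<longleftrightarrow> \<alpha> j > 0 \<and> slack X \<alpha> j > 0 \<or> \<alpha> j = 0 \<and> (\<forall>i\<in>{1..n}. X i j = 0)"

text \<open>The bound \<open>X i j \<le> 1\<close> is recovered from the row sum, whose terms are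
  nonnegative.\<close>

lemma feasible_iff:
  "(X, \<alpha>) \<in> qpp_feasible n k lam \<mu> \<longleftrightarrow>
     (\<forall>j\<in>{1..k}. stable X \<alpha> j) \<and> (\<Sum>j=1..k. \<alpha> j) = 1 \<and>
     (\<forall>i\<in>{1..n}. (\<Sum>j=1..k. X i j) = 1) \<and> (\<forall>i\<in>{1..n}. \<forall>j\<in>{1..k}. X i j \<ge> 0)"
proof -
  have stable: "stable X \<alpha> j \<longleftrightarrow> \<alpha> j \<ge> 0 \<and> (\<alpha> j > 0 \<longrightarrow> load X j < \<alpha> j)
      \<and> (\<not> \<alpha> j > 0 \<longrightarrow> (\<forall>i\<in>{1..n}. X i j = 0))" for j
    unfolding stable_def slack_def by (cases "\<alpha> j" "0 :: real" rule: linorder_cases) simp_all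
  have unit: "X i j \<in> {0..1}" if "\<forall>i\<in>{1..n}. (\<Sum>j=1..k. X i j) = 1" "\<forall>i\<in>{1..n}. \<forall>j\<in>{1..k}. X i j \<ge> 0"
    and "i \<in> {1..n}" "j \<in> {1..k}" for i j
  proof -
    have "X i j \<le> (\<Sum>j=1..k. X i j)" using that by (intro member_le_sum) auto
    with that show ?thesis by simp
  qed
  have nonneg: "0 \<le> X i j" if "X i j \<in> {0..1}" for i j using that by simp
  have "(X, \<alpha>) \<in> stable_set n k lam \<mu> \<and> (\<forall>j\<in>{1..k}. \<alpha> j \<ge> 0) \<longleftrightarrow> (\<forall>j\<in>{1..k}. stable X \<alpha> j)"
    unfolding stable stable_set_def active_queues_def load_def by blast
  then show ?thesis
    unfolding qpp_feasible_def mem_Collect_eq split_conv using unit nonneg by blast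
qed

lemma expected_wait_eq:
  assumes "\<forall>j\<in>{1..k}. stable X \<alpha> j"
  shows "expected_wait n k lam \<mu> v (X, \<alpha>) = total_cost X \<alpha> / (2 * (\<Sum>i=1..n. lam i))"
proof -
  have "expected_wait n k lam \<mu> v (X, \<alpha>)
      = (\<Sum>j\<in>active_queues k \<alpha>. cost X \<alpha> j / (2 * (\<Sum>i=1..n. lam i)))"
    unfolding expected_wait_def cost_def moment_def arrivals_def slack_def load_def
    by (simp add: power2_eq_square algebra_simps)
  also have "\<dots> = (\<Sum>j=1..k. cost X \<alpha> j / (2 * (\<Sum>i=1..n. lam i)))"
    using assms by (intro sum.mono_neutral_left)
      (auto simp: active_queues_def stable_def cost_def)
  finally show ?thesis by (simp add: total_cost_def sum_divide_distrib)
qed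

lemma positive_if_types:
  assumes "\<forall>i\<in>{1..n}. X i j \<ge> 0" "types X j \<noteq> {}"
  shows load_pos: "load X j > 0" and arrivals_pos: "arrivals X j > 0" and moment_pos: "moment X j > 0"
proof -
  obtain i where i: "i \<in> {1..n}" "X i j > 0" using assms by (auto simp: types_def)
  show "load X j > 0" "arrivals X j > 0" "moment X j > 0"
    unfolding load_def arrivals_def moment_def
    using i assms lam_pos mu_pos v_pos
    by (auto intro!: sum_pos2[of _ i] simp: less_imp_le)
qed

end

section \<open>Changes of an optimum within two queues\<close>

locale optimal_partition = partition_problem +
  fixes X :: "nat \<Rightarrow> nat \<Rightarrow> real" and \<alpha> :: "nat \<Rightarrow> real"
  assumes feasible: "(X, \<alpha>) \<in> qpp_feasible n k lam \<mu>"
    and optimal: "(Y, \<beta>) \<in> qpp_feasible n k lam \<mu> \<Longrightarrow> total_cost X \<alpha> \<le> total_cost Y \<beta>"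
begin

lemma X_nonneg: "i \<in> {1..n} \<Longrightarrow> j \<in> {1..k} \<Longrightarrow> X i j \<ge> 0"
  using feasible by (auto simp: feasible_iff)

text \<open>Queues are coupled only through the row sums and the total capacity, which the change
  preserves; the costs of all other queues cancel.\<close>

lemma two_queue_optimal:
  assumes pq: "p \<in> {1..k}" "q \<in> {1..k}" "p \<noteq> q"
    and same: "\<And>i j. j \<noteq> p \<Longrightarrow> j \<noteq> q \<Longrightarrow> Y i j = X i j" "\<And>j. j \<noteq> p \<Longrightarrow> j \<noteq> q \<Longrightarrow> \<beta> j = \<alpha> j"
    and total: "\<And>i. i \<in> {1..n} \<Longrightarrow> Y i p + Y i q = X i p + X i q" "\<beta> p + \<beta> q = \<alpha> p + \<alpha> q"
    and nonneg: "\<And>i. i \<in> {1..n} \<Longrightarrow> Y i p \<ge> 0" "\<And>i. i \<in> {1..n} \<Longrightarrow> Y i q \<ge> 0"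
    and stable: "stable Y \<beta> p" "stable Y \<beta> q"
  shows "cost X \<alpha> p + cost X \<alpha> q \<le> cost Y \<beta> p + cost Y \<beta> q"
proof -
  have split: "(\<Sum>j=1..k. g j) = g p + g q + (\<Sum>j\<in>{1..k} - {p, q}. g j)" for g :: "nat \<Rightarrow> real"
    using pq sum.subset_diff[of "{p, q}" "{1..k}" g] by (auto simp: add.commute)
  have eq: "load Y j = load X j" "arrivals Y j = arrivals X j" "moment Y j = moment X j"
    if "j \<noteq> p" "j \<noteq> q" for j
    unfolding load_def arrivals_def moment_def using same that by simp_all
  have costs: "cost Y \<beta> j = cost X \<alpha> j" if "j \<noteq> p" "j \<noteq> q" for j
    unfolding cost_def slack_def using eq same that by simp
  have "(Y, \<beta>) \<in> qpp_feasible n k lam \<mu>"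
    unfolding feasible_iff
  proof (intro conjI ballI)
    fix j assume "j \<in> {1..k}"
    then have "stable X \<alpha> j" using feasible by (auto simp: feasible_iff)
    then show "stable Y \<beta> j"
      using stable eq(1)[of j] same[of j] by (cases "j = p \<or> j = q") (auto simp: stable_def slack_def)
  next
    have "(\<Sum>j=1..k. \<beta> j) = (\<Sum>j=1..k. \<alpha> j)"
      unfolding split using total same by simp
    then show "(\<Sum>j=1..k. \<beta> j) = 1" using feasible by (auto simp: feasible_iff)
  next
    fix i assume i: "i \<in> {1..n}"
    then have "(\<Sum>j=1..k. Y i j) = (\<Sum>j=1..k. X i j)"
      unfolding split using total same by simp
    then show "(\<Sum>j=1..k. Y i j) = 1" using feasible i by (auto simp: feasible_iff)
  next
    fix i j assume "i \<in> {1..n}" "j \<in> {1..k}"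
    then show "Y i j \<ge> 0"
      using nonneg[of i] X_nonneg[of i j] same(1)[of j i] by (cases "j = p \<or> j = q") auto
  qed
  from optimal[OF this] show ?thesis
    unfolding total_cost_def split using costs by simp
qed

end

locale optimal_queue_pair = optimal_partition +
  fixes p q :: nat
  assumes pq: "p \<in> {1..k}" "q \<in> {1..k}" "p \<noteq> q"
    and nonempty: "types X p \<noteq> {}" "types X q \<noteq> {}"
begin

lemma swap: "optimal_queue_pair n k lam \<mu> v X \<alpha> q p"
  using pq nonempty by unfold_locales auto

lemma pos:
  assumes "j = p \<or> j = q"
  shows "load X j > 0" "arrivals X j > 0" "moment X j > 0" "slack X \<alpha> j > 0" "\<alpha> j > 0" "cost X \<alpha> j > 0"
proof -
  have *: "j \<in> {1..k}" "types X j \<noteq> {}" using assms pq nonempty by auto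
  then show A: "load X j > 0" "arrivals X j > 0" "moment X j > 0"
    using positive_if_types[of X j] X_nonneg by blast+
  have "stable X \<alpha> j" using feasible * by (auto simp: feasible_iff)
  then show B: "slack X \<alpha> j > 0" "\<alpha> j > 0"
    using * by (auto simp: stable_def types_def)
  show "cost X \<alpha> j > 0" unfolding cost_def using A B by simp
qed

text \<open>
  Moves the load \<open>t * d i\<close> of each type \<open>i\<close> from queue \<open>q\<close> to queue \<open>p\<close>, together with the
  slack \<open>t * \<eta>\<close>.
\<close>

lemma eventually_no_gain:
  fixes d :: "nat \<Rightarrow> real" and \<eta> :: real
  assumes d: "\<And>i. i \<in> {1..n} \<Longrightarrow> d i > 0 \<Longrightarrow> i \<in> types X q"
    "\<And>i. i \<in> {1..n} \<Longrightarrow> d i < 0 \<Longrightarrow> i \<in> types X p"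
    and dM: "dM = (\<Sum>i=1..n. d i * (v i * \<mu> i))"
    and dA: "dA = (\<Sum>i=1..n. d i * \<mu> i)"
    and dC: "dC = \<eta> + (\<Sum>i=1..n. d i)"
  shows "eventually (\<lambda>t. cost X \<alpha> p + cost X \<alpha> q
    \<le> cost X \<alpha> p * ratio (dM / moment X p) (dA / arrivals X p) (\<eta> / slack X \<alpha> p) (dC / \<alpha> p) t
     + cost X \<alpha> q * ratio (- dM / moment X q) (- dA / arrivals X q) (- \<eta> / slack X \<alpha> q) (- dC / \<alpha> q) t)
    (at_right 0)"
proof -
  \<comment> \<open>The load \<open>d i\<close> of type \<open>i\<close> corresponds to the fraction
    \<open>d i * \<mu> i / lam i\<close> of its customers.\<close>
  define \<epsilon> where "\<epsilon> i = d i * \<mu> i / lam i" for i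
  have sgn: "\<epsilon> i > 0 \<longleftrightarrow> d i > 0" "\<epsilon> i < 0 \<longleftrightarrow> d i < 0" if "i \<in> {1..n}" for i
    using lam_pos[OF that] mu_pos[OF that] unfolding \<epsilon>_def
    by (simp_all add: zero_less_divide_iff divide_less_0_iff zero_less_mult_iff mult_less_0_iff)
  \<comment> \<open>Only a decreasing fraction needs a positive start, and \<open>d\<close> lets a
    type leave only a queue that serves it.\<close>
  have evp: "eventually (\<lambda>t. \<forall>i\<in>{1..n}. 0 \<le> X i p + t * \<epsilon> i) (at_right 0)"
  proof (intro eventually_ball_finite ballI eventually_affine_nonneg)
    fix i assume i: "i \<in> {1..n}"
    then show "X i p \<ge> 0" using X_nonneg pq by blast
    assume "\<epsilon> i < 0"
    then show "X i p > 0" using d(2)[OF i] sgn(2)[OF i] by (simp add: types_def)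
  qed simp
  have evq: "eventually (\<lambda>t. \<forall>i\<in>{1..n}. 0 \<le> X i q + t * (- \<epsilon> i)) (at_right 0)"
  proof (intro eventually_ball_finite ballI eventually_affine_nonneg)
    fix i assume i: "i \<in> {1..n}"
    then show "X i q \<ge> 0" using X_nonneg pq by blast
    assume "- \<epsilon> i < 0"
    then show "X i q > 0" using d(1)[OF i] sgn(1)[OF i] by (simp add: types_def)
  qed simp
  have eps: "lam i * \<epsilon> i / \<mu> i = d i" "lam i * \<epsilon> i = d i * \<mu> i" if "i \<in> {1..n}" for i
    using lam_pos[OF that] mu_pos[OF that] by (simp_all add: \<epsilon>_def)
  note pp = pos[of p, simplified] and pq' = pos[of q, simplified]
  show ?thesis
    using evp evq eventually_affine_pos[OF pp(4), of \<eta>] eventually_affine_pos[OF pp(5), of dC]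
      eventually_affine_pos[OF pq'(4), of "- \<eta>"] eventually_affine_pos[OF pq'(5), of "- dC"]
  proof eventually_elim
    case (elim t)
    define Y where "Y = (\<lambda>i j. if j = p then X i p + t * \<epsilon> i
      else if j = q then X i q + t * (- \<epsilon> i) else X i j)"
    define \<beta> where "\<beta> = (\<lambda>j. if j = p then \<alpha> p + t * dC else if j = q then \<alpha> q - t * dC else \<alpha> j)"
    have Y: "Y i p = X i p + t * \<epsilon> i" "Y i q = X i q + t * (- \<epsilon> i)" for i
      using pq by (simp_all add: Y_def)
    have load: "load Y p = load X p + t * (\<Sum>i=1..n. d i)" "load Y q = load X q - t * (\<Sum>i=1..n. d i)"
    proof -
      have "lam i * Y i p / \<mu> i = lam i * X i p / \<mu> i + t * d i"
        "lam i * Y i q / \<mu> i = lam i * X i q / \<mu> i - t * d i" if "i \<in> {1..n}" for i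
        unfolding Y eps(1)[OF that, symmetric]
        by (simp_all add: algebra_simps add_divide_distrib diff_divide_distrib)
      then show "load Y p = load X p + t * (\<Sum>i=1..n. d i)" "load Y q = load X q - t * (\<Sum>i=1..n. d i)"
        unfolding load_def sum_distrib_left sum.distrib[symmetric] sum_subtractf[symmetric]
        by (intro sum.cong; blast)+
    qed
    have arr: "arrivals Y p = arrivals X p + t * dA" "arrivals Y q = arrivals X q - t * dA"
    proof -
      have "Y i p * lam i = X i p * lam i + t * (d i * \<mu> i)"
        "Y i q * lam i = X i q * lam i - t * (d i * \<mu> i)" if "i \<in> {1..n}" for i
        unfolding Y eps(2)[OF that, symmetric] by (simp_all add: algebra_simps)
      then show "arrivals Y p = arrivals X p + t * dA" "arrivals Y q = arrivals X q - t * dA"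
        unfolding arrivals_def dA sum_distrib_left sum.distrib[symmetric] sum_subtractf[symmetric]
        by (intro sum.cong; blast)+
    qed
    have mom: "moment Y p = moment X p + t * dM" "moment Y q = moment X q - t * dM"
    proof -
      have "lam i * Y i p * v i = lam i * X i p * v i + t * (d i * \<mu> i * v i)"
        "lam i * Y i q * v i = lam i * X i q * v i - t * (d i * \<mu> i * v i)" if "i \<in> {1..n}" for i
        unfolding Y eps(2)[OF that, symmetric] by (simp_all add: algebra_simps)
      then show "moment Y p = moment X p + t * dM" "moment Y q = moment X q - t * dM"
        unfolding moment_def dM sum_distrib_left sum.distrib[symmetric] sum_subtractf[symmetric]
        by (intro sum.cong; simp add: mult_ac)+
    qed
    have sl: "slack Y \<beta> p = slack X \<alpha> p + t * \<eta>" "slack Y \<beta> q = slack X \<alpha> q - t * \<eta>"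
      unfolding slack_def load using pq by (simp_all add: \<beta>_def dC algebra_simps)
    have be: "\<beta> p = \<alpha> p + t * dC" "\<beta> q = \<alpha> q - t * dC" using pq by (simp_all add: \<beta>_def)
    have "cost X \<alpha> p + cost X \<alpha> q \<le> cost Y \<beta> p + cost Y \<beta> q"
    proof (rule two_queue_optimal[OF pq])
      show "stable Y \<beta> p" "stable Y \<beta> q" unfolding stable_def sl be using elim by simp_all
    qed (use elim pq in \<open>auto simp: Y_def \<beta>_def\<close>)
    also have "cost Y \<beta> p
      = cost X \<alpha> p * ratio (dM / moment X p) (dA / arrivals X p) (\<eta> / slack X \<alpha> p) (dC / \<alpha> p) t"
      unfolding cost_def mom arr sl be by (rule ratio_scale) (use pp in simp_all)
    also have "cost Y \<beta> q
      = cost X \<alpha> q * ratio (- dM / moment X q) (- dA / arrivals X q) (- \<eta> / slack X \<alpha> q) (- dC / \<alpha> q) t"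
      unfolding cost_def mom arr sl be
      using ratio_scale[of "moment X q" "arrivals X q" "slack X \<alpha> q" "\<alpha> q" t "- dM" "- dA" "- \<eta>" "- dC"] pq'
      by simp
    finally show ?case .
  qed
qed

text \<open>Queue \<open>q\<close> is closed: with capacity 0 and no customers it is stable and
  costs 0, while slacks and capacities add up in \<open>p\<close>.\<close>

lemma pooling_no_gain:
  "cost X \<alpha> p + cost X \<alpha> q \<le> (moment X p + moment X q) * (arrivals X p + arrivals X q)
    / ((slack X \<alpha> p + slack X \<alpha> q) * (\<alpha> p + \<alpha> q))"
proof -
  define Y where "Y = (\<lambda>i j. if j = p then X i p + X i q else if j = q then 0 else X i j)"
  define \<beta> where "\<beta> = (\<lambda>j. if j = p then \<alpha> p + \<alpha> q else if j = q then 0 else \<alpha> j)"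
  have "load Y p = load X p + load X q" "moment Y p = moment X p + moment X q"
    "arrivals Y p = arrivals X p + arrivals X q"
    unfolding load_def moment_def arrivals_def Y_def
    by (simp_all add: algebra_simps add_divide_distrib sum.distrib)
  moreover have "\<beta> p = \<alpha> p + \<alpha> q" by (simp add: \<beta>_def)
  ultimately have Yp: "slack Y \<beta> p = slack X \<alpha> p + slack X \<alpha> q" "moment Y p = moment X p + moment X q"
    "arrivals Y p = arrivals X p + arrivals X q" "\<beta> p = \<alpha> p + \<alpha> q"
    by (simp_all add: slack_def)
  have "cost X \<alpha> p + cost X \<alpha> q \<le> cost Y \<beta> p + cost Y \<beta> q"
  proof (rule two_queue_optimal[OF pq])
    show "stable Y \<beta> p" unfolding stable_def Yp using pos by (simp add: add_pos_pos)
    show "stable Y \<beta> q" using pq by (simp add: stable_def Y_def \<beta>_def)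
  qed (use pq X_nonneg in \<open>auto simp: Y_def \<beta>_def\<close>)
  also have "cost Y \<beta> q = 0" using pq by (simp add: cost_def \<beta>_def)
  finally show ?thesis by (simp add: cost_def[of Y] Yp)
qed

end

section \<open>Bounds by the extreme type of a queue\<close>

context partition_problem
begin

text \<open>Per unit of load, type \<open>i\<close> adds \<open>v i * \<mu> i\<close> to the second
  moment and \<open>\<mu> i\<close> to the arrival rate. The former is nondecreasing and the latter
  decreasing in \<open>i\<close>, so both bounds hold type by type.\<close>

lemma moments_of_low_types:
  assumes "\<forall>i\<in>{1..n}. X i j \<ge> 0" "m \<in> {1..n}" "\<And>i. i \<in> types X j \<Longrightarrow> i \<le> m"
  shows "moment X j \<le> v m * \<mu> m * load X j" "\<mu> m * load X j \<le> arrivals X j"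
proof -
  have *: "lam i * X i j * v i \<le> v m * \<mu> m * (lam i * X i j / \<mu> i)
    \<and> \<mu> m * (lam i * X i j / \<mu> i) \<le> X i j * lam i" if i: "i \<in> {1..n}" for i
  proof (cases "X i j = 0")
    case False
    then have "i \<in> types X j" using assms i by (auto simp: types_def less_le)
    then have "i \<le> m" using assms by blast
    then have "v i * \<mu> i \<le> v m * \<mu> m" "\<mu> m \<le> \<mu> i"
      using moment_ratio_mono[OF i assms(2)] mu_decreasing[OF i assms(2)] by (cases "i = m"; simp)+
    moreover have "0 \<le> lam i * X i j / \<mu> i"
      using lam_pos[OF i] mu_pos[OF i] assms(1) i by simp
    ultimately have "v i * \<mu> i * (lam i * X i j / \<mu> i) \<le> v m * \<mu> m * (lam i * X i j / \<mu> i)"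
      "\<mu> m * (lam i * X i j / \<mu> i) \<le> \<mu> i * (lam i * X i j / \<mu> i)"
      by (intro mult_right_mono; simp)+
    then show ?thesis using mu_pos[OF i] by (simp add: mult_ac)
  qed simp
  show "moment X j \<le> v m * \<mu> m * load X j" "\<mu> m * load X j \<le> arrivals X j"
    unfolding moment_def load_def arrivals_def sum_distrib_left
    using * by (auto intro!: sum_mono simp: mult.assoc)
qed

lemma moments_of_high_types:
  assumes "\<forall>i\<in>{1..n}. X i j \<ge> 0" "m \<in> {1..n}" "\<And>i. i \<in> types X j \<Longrightarrow> m \<le> i"
  shows "v m * \<mu> m * load X j \<le> moment X j" "arrivals X j \<le> \<mu> m * load X j"
proof -
  have *: "v m * \<mu> m * (lam i * X i j / \<mu> i) \<le> lam i * X i j * v i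
    \<and> X i j * lam i \<le> \<mu> m * (lam i * X i j / \<mu> i)" if i: "i \<in> {1..n}" for i
  proof (cases "X i j = 0")
    case False
    then have "i \<in> types X j" using assms i by (auto simp: types_def less_le)
    then have "m \<le> i" using assms by blast
    then have "v m * \<mu> m \<le> v i * \<mu> i" "\<mu> i \<le> \<mu> m"
      using moment_ratio_mono[OF assms(2) i] mu_decreasing[OF assms(2) i] by (cases "i = m"; simp)+
    moreover have "0 \<le> lam i * X i j / \<mu> i"
      using lam_pos[OF i] mu_pos[OF i] assms(1) i by simp
    ultimately have "v m * \<mu> m * (lam i * X i j / \<mu> i) \<le> v i * \<mu> i * (lam i * X i j / \<mu> i)"
      "\<mu> i * (lam i * X i j / \<mu> i) \<le> \<mu> m * (lam i * X i j / \<mu> i)"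
      by (intro mult_right_mono; simp)+
    then show ?thesis using mu_pos[OF i] by (simp add: mult_ac)
  qed simp
  show "v m * \<mu> m * load X j \<le> moment X j" "arrivals X j \<le> \<mu> m * load X j"
    unfolding moment_def load_def arrivals_def sum_distrib_left
    using * by (auto intro!: sum_mono simp: mult.assoc)
qed

end

section \<open>Optimality conditions for two nonempty queues\<close>

context optimal_queue_pair
begin

text \<open>The derivative of the cost of queue \<open>j\<close> per unit of load of type
  \<open>i\<close> at fixed slack; the capacity then grows by the added load.\<close>

definition marginal :: "nat \<Rightarrow> nat \<Rightarrow> real" where
  "marginal i j = cost X \<alpha> j * (v i * \<mu> i / moment X j + \<mu> i / arrivals X j - 1 / \<alpha> j)"

text \<open>At fixed loads slack can move in either direction, so its marginal value is the same in
  both queues. Capacity changes along with slack, hence the two terms.\<close>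

lemma slack_balance:
  "cost X \<alpha> p * (1 / slack X \<alpha> p + 1 / \<alpha> p) = cost X \<alpha> q * (1 / slack X \<alpha> q + 1 / \<alpha> q)"
proof -
  have "0 \<le> cost X \<alpha> p * slope 0 0 (\<eta> / slack X \<alpha> p) (\<eta> / \<alpha> p)
    + cost X \<alpha> q * slope 0 0 (- \<eta> / slack X \<alpha> q) (- \<eta> / \<alpha> q)" for \<eta> :: real
    using first_order[OF eventually_no_gain[of "\<lambda>_. 0" 0 0 \<eta> \<eta>]] by simp
  from this[of 1] this[of "- 1"] show ?thesis
    unfolding slope_def by (simp add: algebra_simps)
qed

text \<open>The sign of \<open>c\<close> is the direction of the move, so a type served by both
  queues can be tested both ways. The slack carried per unit of load is
  \<open>\<sigma>\<close>.\<close>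

lemma move_type:
  assumes i: "i \<in> {1..n}" and c: "c > 0 \<Longrightarrow> i \<in> types X q" "c < 0 \<Longrightarrow> i \<in> types X p"
    and \<eta>: "\<eta> = c * \<sigma>"
  shows "eventually (\<lambda>t. cost X \<alpha> p + cost X \<alpha> q
    \<le> cost X \<alpha> p * ratio (c * (v i * \<mu> i) / moment X p) (c * \<mu> i / arrivals X p)
        (\<eta> / slack X \<alpha> p) ((\<eta> + c) / \<alpha> p) t
     + cost X \<alpha> q * ratio (- (c * (v i * \<mu> i)) / moment X q) (- (c * \<mu> i) / arrivals X q)
        (- \<eta> / slack X \<alpha> q) (- (\<eta> + c) / \<alpha> q) t) (at_right 0)"
proof (rule eventually_no_gain[where d = "\<lambda>j. if j = i then c else 0"])
  show "c * (v i * \<mu> i) = (\<Sum>j=1..n. (if j = i then c else 0) * (v j * \<mu> j))"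
    "c * \<mu> i = (\<Sum>j=1..n. (if j = i then c else 0) * \<mu> j)"
    "\<eta> + c = \<eta> + (\<Sum>j=1..n. if j = i then c else 0)"
    using i by (simp_all add: if_distrib[of "\<lambda>x. x * _"] cong: if_cong)
qed (use c in \<open>auto split: if_splits\<close>)

lemma marginal_le:
  assumes "i \<in> types X p"
  shows "marginal i p \<le> marginal i q"
proof -
  have i: "i \<in> {1..n}" using assms by (simp add: types_def)
  show ?thesis
    using first_order[OF move_type[OF i, of "- 1" 0 0]] assms
    unfolding slope_def marginal_def by (simp add: algebra_simps)
qed

text \<open>If the capacity term is no larger in \<open>p\<close>, each type of \<open>p\<close> has
  a strictly smaller marginal cost in \<open>q\<close>, against \<open>marginal_le\<close>. If it is
  larger, \<open>slack_balance\<close> makes the slack term smaller in \<open>p\<close>, and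
  \<open>pooling_improves\<close> applies.\<close>

lemma no_dominated_queue:
  assumes "cost X \<alpha> q / moment X q < cost X \<alpha> p / moment X p"
    and "cost X \<alpha> q / arrivals X q < cost X \<alpha> p / arrivals X p"
  shows False
proof (cases "cost X \<alpha> p / \<alpha> p \<le> cost X \<alpha> q / \<alpha> q")
  case True
  obtain i where i: "i \<in> types X p" using nonempty by auto
  then have n: "i \<in> {1..n}" by (simp add: types_def)
  have "v i * \<mu> i * (cost X \<alpha> q / moment X q) < v i * \<mu> i * (cost X \<alpha> p / moment X p)"
    "\<mu> i * (cost X \<alpha> q / arrivals X q) < \<mu> i * (cost X \<alpha> p / arrivals X p)"
    using assms mu_pos[OF n] v_pos[OF n] by (intro mult_strict_left_mono; simp)+
  with True marginal_le[OF i] show False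
    unfolding marginal_def by (simp add: algebra_simps)
next
  case False
  note pp = pos[of p, simplified] and pq' = pos[of q, simplified]
  have "cost X \<alpha> p / slack X \<alpha> p < cost X \<alpha> q / slack X \<alpha> q"
    using slack_balance False by (simp add: algebra_simps)
  moreover have "cost X \<alpha> j / moment X j = arrivals X j / (slack X \<alpha> j * \<alpha> j)"
    "cost X \<alpha> j / arrivals X j = moment X j / (slack X \<alpha> j * \<alpha> j)" if "j = p \<or> j = q" for j
    using pos[OF that] by (simp_all add: cost_def)
  ultimately have "(moment X p + moment X q) * (arrivals X p + arrivals X q)
    / ((slack X \<alpha> p + slack X \<alpha> q) * (\<alpha> p + \<alpha> q)) < cost X \<alpha> p + cost X \<alpha> q"
    unfolding cost_def[of _ _ p] cost_def[of _ _ q]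
    using pooling_improves[of "moment X p" "moment X q" "arrivals X p" "arrivals X q"
      "slack X \<alpha> p" "slack X \<alpha> q" "\<alpha> p" "\<alpha> q"] pp pq' assms False
    by (simp add: cost_def)
  with pooling_no_gain show False by simp
qed

text \<open>
  The two assumptions say that an additional unit of second moment is more expensive in \<open>p\<close> and an
  additional unit of arrival rate is more expensive in \<open>q\<close>, so \<open>p\<close> should get the short jobs.
\<close>

context
  assumes moment_costlier: "cost X \<alpha> q / moment X q \<le> cost X \<alpha> p / moment X p"
    and arrivals_cheaper: "cost X \<alpha> p / arrivals X p \<le> cost X \<alpha> q / arrivals X q"
begin

text \<open>Exchange equal loads of \<open>a\<close> and \<open>b\<close> and shift slack
  \<open>\<eta>\<close> as well. To first order the exchange does not hurt and, by balance, the
  shift is neutral. Optimality thus makes the slope vanish and the curvature nonnegative for every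
  \<open>\<eta>\<close>, which is refuted by a suitable \<open>\<eta>\<close>.\<close>

lemma no_inversion:
  assumes a: "a \<in> types X q" and b: "b \<in> types X p"
  shows "b \<le> a"
proof (rule ccontr)
  assume "\<not> b \<le> a"
  then have "a < b" by simp
  have n: "a \<in> {1..n}" "b \<in> {1..n}" using a b by (simp_all add: types_def)
  define \<delta> \<epsilon> where "\<delta> = v b * \<mu> b - v a * \<mu> a" and "\<epsilon> = \<mu> a - \<mu> b"
  have \<delta>: "\<delta> \<ge> 0" and \<epsilon>: "\<epsilon> > 0"
    using moment_ratio_mono[OF n] mu_decreasing[OF n] \<open>a < b\<close> by (simp_all add: \<delta>_def \<epsilon>_def)
  define d :: "nat \<Rightarrow> real" where "d = (\<lambda>i. (if i = a then 1 else 0) - (if i = b then 1 else 0))"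
  have sums: "- \<delta> = (\<Sum>i=1..n. d i * (v i * \<mu> i))" "\<epsilon> = (\<Sum>i=1..n. d i * \<mu> i)" "0 = (\<Sum>i=1..n. d i)"
    using n unfolding d_def \<delta>_def \<epsilon>_def
    by (simp_all add: left_diff_distrib sum_subtractf if_distrib[of "\<lambda>x. x * _"] cong: if_cong)
  note pp = pos[of p, simplified] and pq' = pos[of q, simplified]
  define f g where "f = cost X \<alpha> p" and "g = cost X \<alpha> q"
  define x1 y1 x2 y2 where "x1 = - \<delta> / moment X p" and "y1 = \<epsilon> / arrivals X p"
    and "x2 = \<delta> / moment X q" and "y2 = - \<epsilon> / arrivals X q"
  define S1 C1 S2 C2 where "S1 = 1 / slack X \<alpha> p" and "C1 = 1 / \<alpha> p"
    and "S2 = 1 / slack X \<alpha> q" and "C2 = 1 / \<alpha> q"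
  have ev: "eventually (\<lambda>t. f + g \<le> f * ratio x1 y1 (\<eta> * S1) (\<eta> * C1) t
    + g * ratio x2 y2 (- \<eta> * S2) (- \<eta> * C2) t) (at_right 0)" for \<eta>
    using eventually_no_gain[OF _ _ sums(1,2), of \<eta> \<eta>] a b sums(3)
    by (simp add: d_def f_def g_def x1_def x2_def y1_def y2_def S1_def S2_def C1_def C2_def
        split: if_splits)
  have balance: "f * (S1 + C1) = g * (S2 + C2)"
    using slack_balance by (simp add: f_def g_def S1_def C1_def S2_def C2_def)
  have slope: "f * slope x1 y1 (\<eta> * S1) (\<eta> * C1) + g * slope x2 y2 (- \<eta> * S2) (- \<eta> * C2)
    = \<delta> * (g / moment X q - f / moment X p) + \<epsilon> * (f / arrivals X p - g / arrivals X q)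
      - \<eta> * (f * (S1 + C1) - g * (S2 + C2))" for \<eta>
    unfolding slope_def x1_def x2_def y1_def y2_def by (simp add: algebra_simps)
  have "\<delta> * (g / moment X q - f / moment X p) \<le> 0" "\<epsilon> * (f / arrivals X p - g / arrivals X q) \<le> 0"
    using moment_costlier arrivals_cheaper \<delta> \<epsilon> by (simp_all add: f_def g_def mult_nonneg_nonpos)
  then have "f * slope x1 y1 (\<eta> * S1) (\<eta> * C1) + g * slope x2 y2 (- \<eta> * S2) (- \<eta> * C2) \<le> 0" for \<eta>
    unfolding slope balance by simp
  then have "f * slope x1 y1 (\<eta> * S1) (\<eta> * C1) + g * slope x2 y2 (- \<eta> * S2) (- \<eta> * C2) = 0" for \<eta>
    using first_order[OF ev[of \<eta>]] by (rule antisym)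
  from second_order[OF ev this]
  have curv: "0 \<le> f * curvature x1 y1 (\<eta> * S1) (\<eta> * C1) + g * curvature x2 y2 (- \<eta> * S2) (- \<eta> * C2)" for \<eta> .
  have fg: "f > 0" "g > 0" using pp pq' by (simp_all add: f_def g_def)
  have SC: "S1 > 0" "C1 > 0" "S2 > 0" "C2 > 0" using pp pq' by (simp_all add: S1_def C1_def S2_def C2_def)
  \<comment> \<open>Without a shift of slack, second moment and arrival rate change in opposite
    senses in each queue, so the curvature is at most 0. This forces \<open>\<delta> = 0\<close>, as
    \<open>\<epsilon> > 0\<close>.\<close>
  have "0 \<le> f * (x1 * y1) + g * (x2 * y2)"
    using curv[of 0] by (simp add: curvature_def)
  moreover have "f * (x1 * y1) + g * (x2 * y2)
    = - (\<delta> * \<epsilon> * (f / (moment X p * arrivals X p) + g / (moment X q * arrivals X q)))"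
    unfolding x1_def x2_def y1_def y2_def by (simp add: algebra_simps)
  moreover have "0 < f / (moment X p * arrivals X p) + g / (moment X q * arrivals X q)"
    using fg pp pq' by (simp add: add_pos_pos)
  ultimately have "\<delta> * \<epsilon> \<le> 0" by (simp add: mult_le_0_iff)
  with \<delta> \<epsilon> have "\<delta> = 0" by (simp add: mult_le_0_iff)
  then have x0: "x1 = 0" "x2 = 0" by (simp_all add: x1_def x2_def)
  \<comment> \<open>With the second moments unchanged, the curvature is the quadratic
    \<open>\<eta> * (\<eta> * B - K)\<close>. It is negative between 0 and \<open>K / B\<close>, and
    the midpoint is tested.\<close>
  define K where "K = f * (S1 + C1) * (y1 - y2)"
  define B where "B = f * (S1\<^sup>2 + S1 * C1 + C1\<^sup>2) + g * (S2\<^sup>2 + S2 * C2 + C2\<^sup>2)"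
  have "K > 0" unfolding K_def y1_def y2_def using \<epsilon> fg SC pp pq'
    by (intro mult_pos_pos) (simp_all add: add_pos_pos)
  have "B > 0" unfolding B_def using fg SC by (intro add_pos_pos mult_pos_pos) simp_all
  have "0 \<le> \<eta> * (\<eta> * B - K)" for \<eta>
  proof -
    have "f * curvature x1 y1 (\<eta> * S1) (\<eta> * C1) + g * curvature x2 y2 (- \<eta> * S2) (- \<eta> * C2)
      = \<eta> * (\<eta> * B) - \<eta> * (f * (S1 + C1) * y1 - g * (S2 + C2) * y2)"
      unfolding curvature_def slope_def x0 B_def by (simp add: algebra_simps power2_eq_square)
    also have "f * (S1 + C1) * y1 - g * (S2 + C2) * y2 = K"
      unfolding K_def balance by (simp add: algebra_simps)
    finally show ?thesis using curv[of \<eta>] by (simp add: algebra_simps)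
  qed
  from this[of "K / (2 * B)"] have "0 \<le> K / (2 * B) * (- (K / 2))"
    using \<open>B > 0\<close> by simp
  moreover have "0 < K / (2 * B)" "0 < K / 2" using \<open>K > 0\<close> \<open>B > 0\<close> by simp_all
  ultimately show False by (simp only: zero_le_mult_iff) linarith
qed

text \<open>Optimality requires a nonnegative total curvature along a stationary move of
  \<open>i\<close>, whereas \<open>split_curvature\<close> makes each part at most 0. In the
  equality case both queues have the totals of queues serving \<open>i\<close> alone, and pooling
  them is better.\<close>

lemma no_split:
  assumes ip: "i \<in> types X p" and iq: "i \<in> types X q"
  shows False
proof -
  have n: "i \<in> {1..n}" using ip by (simp add: types_def)
  note pp = pos[of p, simplified] and pq' = pos[of q, simplified]
  define f g where "f = cost X \<alpha> p" and "g = cost X \<alpha> q"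
  define x1 y1 x2 y2 where "x1 = v i * \<mu> i / moment X p" and "y1 = \<mu> i / arrivals X p"
    and "x2 = v i * \<mu> i / moment X q" and "y2 = \<mu> i / arrivals X q"
  define s1 s2 p1 p2 where "s1 = slack X \<alpha> p" and "s2 = slack X \<alpha> q"
    and "p1 = load X p" and "p2 = load X q"
  have fg: "f > 0" "g > 0" using pp pq' by (simp_all add: f_def g_def)
  have ps: "p1 > 0" "p2 > 0" "s1 > 0" "s2 > 0"
    using pp pq' by (simp_all add: p1_def p2_def s1_def s2_def)
  have \<alpha>: "\<alpha> p = s1 + p1" "\<alpha> q = s2 + p2"
    by (simp_all add: slack_def p1_def p2_def s1_def s2_def)
  have ev: "eventually (\<lambda>t. f + g
      \<le> f * ratio (c * x1) (c * y1) (c * (\<sigma> / s1)) (c * ((1 + \<sigma>) / (s1 + p1))) t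
      + g * ratio (- (c * x2)) (- (c * y2)) (- (c * (\<sigma> / s2))) (- (c * ((1 + \<sigma>) / (s2 + p2)))) t)
      (at_right 0)" for c \<sigma>
  proof -
    have "c * x1 = c * (v i * \<mu> i) / moment X p" "c * y1 = c * \<mu> i / arrivals X p"
      "c * (\<sigma> / s1) = c * \<sigma> / slack X \<alpha> p" "c * ((1 + \<sigma>) / (s1 + p1)) = (c * \<sigma> + c) / \<alpha> p"
      "c * x2 = c * (v i * \<mu> i) / moment X q" "c * y2 = c * \<mu> i / arrivals X q"
      "c * (\<sigma> / s2) = c * \<sigma> / slack X \<alpha> q" "c * ((1 + \<sigma>) / (s2 + p2)) = (c * \<sigma> + c) / \<alpha> q"
      unfolding \<alpha> x1_def x2_def y1_def y2_def s1_def s2_def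
      by (simp_all add: distrib_left add.commute)
    then show ?thesis
      unfolding f_def g_def using move_type[OF n iq ip refl, of c \<sigma>] by (simp only: minus_divide_left)
  qed
  have slope_eq: "f * slope x1 y1 (\<sigma> / s1) ((1 + \<sigma>) / (s1 + p1))
      = g * slope x2 y2 (\<sigma> / s2) ((1 + \<sigma>) / (s2 + p2))" for \<sigma>
    using first_order[OF ev[of 1 \<sigma>]] first_order[OF ev[of "- 1" \<sigma>]]
    by (simp add: slope_uminus del: minus_add_distrib)
  \<comment> \<open>This \<open>\<sigma>\<close> solves the linear equation that makes the slope in
    \<open>p\<close> vanish; \<open>slope_eq\<close> carries this over to \<open>q\<close>.\<close>
  define \<sigma> where "\<sigma> = (x1 + y1 - 1 / (s1 + p1)) / (1 / s1 + 1 / (s1 + p1))"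
  have "1 / s1 + 1 / (s1 + p1) > 0" using ps by (simp add: add_pos_pos)
  then have "\<sigma> * (1 / s1 + 1 / (s1 + p1)) = x1 + y1 - 1 / (s1 + p1)" by (simp add: \<sigma>_def)
  then have st1: "slope x1 y1 (\<sigma> / s1) ((1 + \<sigma>) / (s1 + p1)) = 0"
    unfolding slope_def by (simp add: algebra_simps add_divide_distrib)
  with slope_eq[of \<sigma>] fg have st2: "slope x2 y2 (\<sigma> / s2) ((1 + \<sigma>) / (s2 + p2)) = 0" by simp
  have curv: "0 \<le> f * curvature x1 y1 (\<sigma> / s1) ((1 + \<sigma>) / (s1 + p1))
      + g * curvature x2 y2 (\<sigma> / s2) ((1 + \<sigma>) / (s2 + p2))"
    using second_order[OF ev[of 1 \<sigma>]] st1 st2 by (simp add: slope_uminus curvature_uminus)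
  have Xp: "\<forall>i\<in>{1..n}. X i p \<ge> 0" and Xq: "\<forall>i\<in>{1..n}. X i q \<ge> 0"
    using X_nonneg pq by blast+
  \<comment> \<open>By \<open>no_inversion\<close>, \<open>i\<close> is the longest type of
    \<open>p\<close> and the shortest of \<open>q\<close>. Relative to its load it adds at least the
    average second moment and at most the average arrival rate of \<open>p\<close>, and conversely
    in \<open>q\<close>.\<close>
  have "moment X p \<le> v i * \<mu> i * load X p" "\<mu> i * load X p \<le> arrivals X p"
    by (rule moments_of_low_types; use Xp n no_inversion[OF iq] in blast)+
  moreover have "v i * \<mu> i * load X q \<le> moment X q" "arrivals X q \<le> \<mu> i * load X q"
    by (rule moments_of_high_types; use Xq n no_inversion[OF _ ip] in blast)+
  ultimately have "x1 \<ge> 1 / p1" "y1 \<le> 1 / p1" "x2 \<le> 1 / p2" "y2 \<ge> 1 / p2"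
    using ps pp pq' unfolding x1_def x2_def y1_def y2_def p1_def p2_def
    by (simp_all add: field_simps)
  then have "(x1 - 1 / p1) * (y1 - 1 / p1) \<le> 0" "(x2 - 1 / p2) * (y2 - 1 / p2) \<le> 0"
    by (simp_all add: mult_le_0_iff)
  note c1 = split_curvature[OF ps(3,1) st1 this(1)] and c2 = split_curvature[OF ps(4,2) st2 this(2)]
  have "f * curvature x1 y1 (\<sigma> / s1) ((1 + \<sigma>) / (s1 + p1)) \<le> 0"
    "g * curvature x2 y2 (\<sigma> / s2) ((1 + \<sigma>) / (s2 + p2)) \<le> 0"
    using c1(1) c2(1) fg by (simp_all add: mult_le_0_iff)
  with curv have "f * curvature x1 y1 (\<sigma> / s1) ((1 + \<sigma>) / (s1 + p1)) = 0"
    "g * curvature x2 y2 (\<sigma> / s2) ((1 + \<sigma>) / (s2 + p2)) = 0" by linarith+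
  with fg c1(2) c2(2) have "x1 = 1 / p1" "y1 = 1 / p1" "x2 = 1 / p2" "y2 = 1 / p2" by simp_all
  then have eq: "moment X p = v i * \<mu> i * p1" "moment X q = v i * \<mu> i * p2"
    "arrivals X p = \<mu> i * p1" "arrivals X q = \<mu> i * p2"
    using ps pp pq' unfolding x1_def x2_def y1_def y2_def by (simp_all add: field_simps)
  have "(moment X p + moment X q) * (arrivals X p + arrivals X q)
    / ((slack X \<alpha> p + slack X \<alpha> q) * (\<alpha> p + \<alpha> q)) < cost X \<alpha> p + cost X \<alpha> q"
    unfolding cost_def eq \<alpha> s1_def[symmetric] s2_def[symmetric]
    using mu_pos[OF n] v_pos[OF n] ps by (intro pooling_improves_single_type) simp_all
  with pooling_no_gain show False by simp
qed

lemma types_ordered: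
  assumes "i \<in> types X p" "j \<in> types X q"
  shows "i < j"
  using no_inversion[OF assms(2,1)] no_split assms by (metis le_neq_implies_less)

end

end

text \<open>The signs of \<open>?dM\<close> and \<open>?dA\<close> decide: opposite signs order the
  two queues one way or the other, and equal strict signs are excluded by
  \<open>no_dominated_queue\<close>.\<close>

lemma (in optimal_partition) types_separated:
  assumes "p \<in> {1..k}" "q \<in> {1..k}" "p \<noteq> q"
  shows "(\<forall>i\<in>types X p. \<forall>j\<in>types X q. i < j) \<or> (\<forall>i\<in>types X p. \<forall>j\<in>types X q. j < i)"
proof (cases "types X p = {} \<or> types X q = {}")
  case False
  then interpret optimal_queue_pair n k lam \<mu> v X \<alpha> p q
    using assms by unfold_locales auto
  interpret swap: optimal_queue_pair n k lam \<mu> v X \<alpha> q p by (rule swap)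
  let ?dM = "cost X \<alpha> p / moment X p - cost X \<alpha> q / moment X q"
  let ?dA = "cost X \<alpha> p / arrivals X p - cost X \<alpha> q / arrivals X q"
  consider "?dM \<ge> 0" "?dA \<le> 0" | "?dM \<le> 0" "?dA \<ge> 0" | "?dM > 0" "?dA > 0" | "?dM < 0" "?dA < 0"
    by linarith
  then show ?thesis
  proof cases
    case 1 then show ?thesis using types_ordered by simp
  next
    case 2 then show ?thesis using swap.types_ordered by simp
  next
    case 3 then show ?thesis using no_dominated_queue by simp
  next
    case 4 then show ?thesis using swap.no_dominated_queue by simp
  qed
qed auto

subsection \<open>Existence of an optimum\<close>

text \<open>Bolzano-Weierstrass for one coordinate after the other, each time along the subsequence
  already extracted.\<close>

lemma coordinatewise_convergent_subsequence:
  fixes x :: "nat \<Rightarrow> 'a \<Rightarrow> real"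
  assumes "finite I" "\<And>i m. i \<in> I \<Longrightarrow> x m i \<in> {a..b}"
  obtains r l where "strict_mono r" "\<And>i. i \<in> I \<Longrightarrow> (\<lambda>m. x (r m) i) \<longlonglongrightarrow> l i"
proof -
  have "\<exists>r l. strict_mono r \<and> (\<forall>i\<in>I. (\<lambda>m. x (r m) i) \<longlonglongrightarrow> l i)"
    using assms
  proof (induction I)
    case empty
    have "strict_mono (id :: nat \<Rightarrow> nat)" by (rule strict_mono_id)
    then show ?case by blast
  next
    case (insert i I)
    then obtain r l where r: "strict_mono (r :: nat \<Rightarrow> nat)" "\<forall>i\<in>I. (\<lambda>m. x (r m) i) \<longlonglongrightarrow> l i"
      by blast
    have "seq_compact {a..b}" using compact_Icc compact_eq_seq_compact_metric by blast
    moreover have "\<forall>m. x (r m) i \<in> {a..b}" using insert.prems by blast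
    ultimately obtain c s where s: "strict_mono (s :: nat \<Rightarrow> nat)" "((\<lambda>m. x (r m) i) \<circ> s) \<longlonglongrightarrow> c"
      by (rule seq_compactE)
    have "(\<lambda>m. x ((r \<circ> s) m) i') \<longlonglongrightarrow> (l(i := c)) i'" if "i' \<in> insert i I" for i'
      using s(2) LIMSEQ_subseq_LIMSEQ[OF bspec[OF r(2)] s(1), of i'] that
      by (cases "i' = i") (simp_all add: o_def)
    with strict_mono_o[OF r(1) s(1)] show ?case by blast
  qed
  with that show ?thesis by blast
qed

context partition_problem
begin

lemma cost_nonneg:
  assumes "stable X \<alpha> j" "\<forall>i\<in>{1..n}. X i j \<ge> 0"
  shows "cost X \<alpha> j \<ge> 0"
proof -
  have "moment X j \<ge> 0" "arrivals X j \<ge> 0"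
    unfolding moment_def arrivals_def using assms(2) lam_pos v_pos
    by (auto intro!: sum_nonneg mult_nonneg_nonneg simp: less_imp_le)
  then show ?thesis using assms(1) by (auto simp: cost_def stable_def)
qed

text \<open>Free of quotients, this form passes to limits in which the slack might vanish. For a
  closed queue both sides are 0.\<close>

lemma moment_arrivals_eq:
  assumes "stable X \<alpha> j"
  shows "moment X j * arrivals X j = cost X \<alpha> j * (slack X \<alpha> j * \<alpha> j)"
  using assms by (auto simp: stable_def cost_def moment_def)

lemma cost_eq_0:
  assumes "\<forall>i\<in>{1..n}. X i j \<ge> 0" "types X j = {}"
  shows "load X j = 0" "cost X \<alpha> j = 0" "\<forall>i\<in>{1..n}. X i j = 0"
proof -
  show 0: "\<forall>i\<in>{1..n}. X i j = 0" using assms by (force simp: types_def less_le)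
  then show "load X j = 0" "cost X \<alpha> j = 0"
    by (simp_all add: load_def cost_def moment_def)
qed

text \<open>The strict stability condition may be lost in a limit. Along a minimizing sequence,
  however, the costs stay bounded, which keeps the limit slack positive in every queue that serves
  some type in the limit.\<close>

lemma exists_minimizer:
  assumes ne: "qpp_feasible n k lam \<mu> \<noteq> {}"
  obtains X \<alpha> where "optimal_partition n k lam \<mu> v X \<alpha>"
proof -
  let ?F = "qpp_feasible n k lam \<mu>"
  have total_nonneg: "total_cost X \<alpha> \<ge> 0" if "(X, \<alpha>) \<in> ?F" for X \<alpha>
    unfolding total_cost_def using that cost_nonneg by (intro sum_nonneg) (simp add: feasible_iff)
  define V where "V = (\<lambda>(X, \<alpha>). total_cost X \<alpha>) ` ?F"
  define I where "I = Inf V"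
  have V: "V \<noteq> {}" "bdd_below V" using ne total_nonneg by (auto simp: V_def intro!: bdd_belowI[of _ 0])
  have "\<exists>p\<in>?F. (case p of (X, \<alpha>) \<Rightarrow> total_cost X \<alpha>) < I + 1 / real (Suc m)" for m
  proof -
    have "Inf V < I + 1 / real (Suc m)" by (simp add: I_def)
    then show ?thesis unfolding cInf_less_iff[OF V] by (auto simp: V_def)
  qed
  then obtain P where P: "\<And>m. P m \<in> ?F" "\<And>m. (case P m of (X, \<alpha>) \<Rightarrow> total_cost X \<alpha>) < I + 1 / real (Suc m)"
    by metis
  define x a where "x m = fst (P m)" and "a m = snd (P m)" for m
  have xa: "(x m, a m) \<in> ?F" "total_cost (x m) (a m) < I + 1 / real (Suc m)" for m
    using P[of m] by (simp_all add: x_def a_def split: prod.splits)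
  have st: "stable (x m) (a m) j" if "j \<in> {1..k}" for m j using xa(1)[of m] that by (simp add: feasible_iff)
  have x0: "x m i j \<ge> 0" if "i \<in> {1..n}" "j \<in> {1..k}" for m i j
    using xa(1)[of m] that by (simp add: feasible_iff)
  have x1: "x m i j \<in> {0..1}" if "i \<in> {1..n}" "j \<in> {1..k}" for m i j
    using xa(1)[of m] that unfolding qpp_feasible_def by blast
  have a1: "a m j \<in> {0..1}" if "j \<in> {1..k}" for m j
  proof -
    have 0: "\<forall>j\<in>{1..k}. a m j \<ge> 0" "(\<Sum>j=1..k. a m j) = 1"
      using xa(1)[of m] unfolding qpp_feasible_def by blast+
    then have "a m j \<le> (\<Sum>j=1..k. a m j)" using that by (intro member_le_sum) auto
    with 0 that show ?thesis by simp
  qed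
  \<comment> \<open>Row 0 holds the capacities and rows \<open>1..n\<close> the assignment, so that
    one subsequence works for both.\<close>
  define z where "z m = (\<lambda>(i, j). if i = 0 then a m j else x m i j)" for m
  have zc: "z m c \<in> {0..1}" if "c \<in> {0..n} \<times> {1..k}" for c m
  proof (cases c)
    case (Pair i j)
    with that have "i = 0 \<or> i \<in> {1..n}" "j \<in> {1..k}" by auto
    then show ?thesis using x1[of i j m] a1[of j m] by (cases "i = 0") (simp_all add: z_def Pair)
  qed
  from coordinatewise_convergent_subsequence[of "{0..n} \<times> {1..k}" z, OF _ zc]
  obtain r l where r: "strict_mono r" and l: "\<And>c. c \<in> {0..n} \<times> {1..k} \<Longrightarrow> (\<lambda>m. z (r m) c) \<longlonglongrightarrow> l c"
    by blast
  define X \<alpha> where "X i j = l (i, j)" and "\<alpha> j = l (0, j)" for i j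
  have limX: "(\<lambda>m. x (r m) i j) \<longlonglongrightarrow> X i j" if "i \<in> {1..n}" "j \<in> {1..k}" for i j
    using l[of "(i, j)"] that by (simp add: z_def X_def)
  have lim\<alpha>: "(\<lambda>m. a (r m) j) \<longlonglongrightarrow> \<alpha> j" if "j \<in> {1..k}" for j
    using l[of "(0, j)"] that by (simp add: z_def \<alpha>_def)
  have limL: "(\<lambda>m. load (x (r m)) j) \<longlonglongrightarrow> load X j"
    and limA: "(\<lambda>m. arrivals (x (r m)) j) \<longlonglongrightarrow> arrivals X j"
    and limM: "(\<lambda>m. moment (x (r m)) j) \<longlonglongrightarrow> moment X j" if "j \<in> {1..k}" for j
    unfolding load_def arrivals_def moment_def divide_inverse
    by (intro tendsto_intros limX that; assumption)+
  have limS: "(\<lambda>m. slack (x (r m)) (a (r m)) j) \<longlonglongrightarrow> slack X \<alpha> j" if "j \<in> {1..k}" for j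
    unfolding slack_def using that by (intro tendsto_intros limL lim\<alpha>)
  have X0: "X i j \<ge> 0" if "i \<in> {1..n}" "j \<in> {1..k}" for i j
    using LIMSEQ_le_const[OF limX[OF that]] x0[OF that] by blast
  have Xj: "\<forall>i\<in>{1..n}. X i j \<ge> 0" if "j \<in> {1..k}" for j using X0 that by blast
  have \<alpha>0: "\<alpha> j \<ge> 0" if "j \<in> {1..k}" for j
    using LIMSEQ_le_const[OF lim\<alpha>[OF that], of 0] a1[OF that] by auto
  have s0: "slack X \<alpha> j \<ge> 0" if "j \<in> {1..k}" for j
  proof (rule LIMSEQ_le_const[OF limS[OF that]])
    have "slack (x m) (a m) j \<ge> 0" for m
      using st[OF that, of m] by (auto simp: stable_def slack_def load_def)
    then show "\<exists>N. \<forall>m\<ge>N. 0 \<le> slack (x (r m)) (a (r m)) j" by blast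
  qed
  have cost_le: "cost (x m) (a m) j \<le> I + 1" if "j \<in> {1..k}" for m j
  proof -
    have "cost (x m) (a m) j \<le> total_cost (x m) (a m)"
      unfolding total_cost_def using that cost_nonneg st x0 by (intro member_le_sum) auto
    also have "\<dots> \<le> I + 1 / real (Suc m)" using xa(2)[of m] by simp
    also have "\<dots> \<le> I + 1" by simp
    finally show ?thesis .
  qed
  have loaded: "slack X \<alpha> j > 0 \<and> \<alpha> j > 0 \<and> (\<lambda>m. cost (x (r m)) (a (r m)) j) \<longlonglongrightarrow> cost X \<alpha> j"
    if j: "j \<in> {1..k}" and ne: "types X j \<noteq> {}" for j
  proof -
    note pos = positive_if_types[OF Xj[OF j] ne]
    have \<alpha>: "\<alpha> j > 0" using s0[OF j] pos(1) by (simp add: slack_def)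
    \<comment> \<open>In the limit the left-hand side is positive, so the slack cannot be 0.\<close>
    have "moment (x m) j * arrivals (x m) j \<le> (I + 1) * (slack (x m) (a m) j * a m j)" for m
      unfolding moment_arrivals_eq[OF st[OF j, of m]]
      using cost_le[OF j] st[OF j, of m]
      by (intro mult_right_mono) (auto simp: stable_def)
    then have "moment X j * arrivals X j \<le> (I + 1) * (slack X \<alpha> j * \<alpha> j)"
      using j by (intro LIMSEQ_le[OF tendsto_mult[OF limM limA] tendsto_mult[OF tendsto_const tendsto_mult[OF limS lim\<alpha>]]])
        auto
    moreover have "moment X j * arrivals X j > 0" using pos by simp
    ultimately have "slack X \<alpha> j \<noteq> 0" by auto
    with s0[OF j] have s: "slack X \<alpha> j > 0" by simp
    have "(\<lambda>m. cost (x (r m)) (a (r m)) j) \<longlonglongrightarrow> cost X \<alpha> j"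
      unfolding cost_def using s \<alpha> j by (intro tendsto_intros limM limA limS lim\<alpha>) simp_all
    with s \<alpha> show ?thesis by simp
  qed
  have feas: "(X, \<alpha>) \<in> ?F"
    unfolding feasible_iff
  proof (intro conjI ballI)
    fix j assume j: "j \<in> {1..k}"
    show "stable X \<alpha> j"
    proof (cases "types X j = {}")
      case True
      with cost_eq_0[OF Xj[OF j] True] \<alpha>0[OF j] show ?thesis
        by (cases "\<alpha> j = 0") (simp_all add: stable_def slack_def)
    next
      case False
      with loaded[OF j] show ?thesis by (simp add: stable_def)
    qed
  next
    have "(\<lambda>m. \<Sum>j=1..k. a (r m) j) \<longlonglongrightarrow> (\<Sum>j=1..k. \<alpha> j)" by (intro tendsto_intros lim\<alpha>)
    moreover have "(\<Sum>j=1..k. a m j) = 1" for m using xa(1)[of m] by (simp add: feasible_iff)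
    ultimately show "(\<Sum>j=1..k. \<alpha> j) = 1" by (simp add: LIMSEQ_const_iff)
  next
    fix i assume i: "i \<in> {1..n}"
    have "(\<lambda>m. \<Sum>j=1..k. x (r m) i j) \<longlonglongrightarrow> (\<Sum>j=1..k. X i j)" by (intro tendsto_intros limX i)
    moreover have "(\<Sum>j=1..k. x m i j) = 1" for m using xa(1)[of m] i by (simp add: feasible_iff)
    ultimately show "(\<Sum>j=1..k. X i j) = 1" by (simp add: LIMSEQ_const_iff)
  qed (use X0 in blast)
  \<comment> \<open>The costs of a queue that empties in the limit need not converge to its limit
    cost 0. They are nonnegative, so dropping them only lowers the totals of the sequence.\<close>
  define J where "J = {j \<in> {1..k}. types X j \<noteq> {}}"
  have J: "finite J" "J \<subseteq> {1..k}" by (auto simp: J_def)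
  have "total_cost X \<alpha> = (\<Sum>j\<in>J. cost X \<alpha> j)"
    unfolding total_cost_def using cost_eq_0(2)[OF Xj] J
    by (intro sum.mono_neutral_right) (auto simp: J_def)
  also have "\<dots> \<le> I + 0"
  proof (rule LIMSEQ_le)
    show "(\<lambda>m. \<Sum>j\<in>J. cost (x (r m)) (a (r m)) j) \<longlonglongrightarrow> (\<Sum>j\<in>J. cost X \<alpha> j)"
      using loaded by (intro tendsto_sum) (simp add: J_def)
    show "(\<lambda>m. I + 1 / real (Suc (r m))) \<longlonglongrightarrow> I + 0"
      using LIMSEQ_subseq_LIMSEQ[OF LIMSEQ_inverse_real_of_nat r]
      by (intro tendsto_add tendsto_const) (simp add: o_def inverse_eq_divide)
    have "(\<Sum>j\<in>J. cost (x m) (a m) j) \<le> total_cost (x m) (a m)" for m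
      unfolding total_cost_def using J cost_nonneg st x0 by (intro sum_mono2) auto
    then show "\<exists>N. \<forall>m\<ge>N. (\<Sum>j\<in>J. cost (x (r m)) (a (r m)) j) \<le> I + 1 / real (Suc (r m))"
      using xa(2) by (meson less_imp_le order_trans)
  qed
  finally have "total_cost X \<alpha> \<le> I" by simp
  moreover have "I \<le> total_cost Y \<beta>" if "(Y, \<beta>) \<in> ?F" for Y \<beta>
    unfolding I_def using that V(2) by (intro cInf_lower) (auto simp: V_def)
  ultimately have "total_cost X \<alpha> \<le> total_cost Y \<beta>" if "(Y, \<beta>) \<in> ?F" for Y \<beta>
    using that by (meson order_trans)
  with feas have "optimal_partition n k lam \<mu> v X \<alpha>"
    by unfold_locales
  with that show ?thesis .
qed

end

subsection \<open>From separated sets to thresholds\<close>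

lemma separated_sets_sortable:
  fixes T :: "nat \<Rightarrow> nat set"
  assumes T: "\<And>p. p \<in> {1..k} \<Longrightarrow> T p \<subseteq> {1..n}"
    and sep: "\<And>p q. \<lbrakk>p \<in> {1..k}; q \<in> {1..k}; p \<noteq> q\<rbrakk> \<Longrightarrow>
      (\<forall>i\<in>T p. \<forall>j\<in>T q. i < j) \<or> (\<forall>i\<in>T p. \<forall>j\<in>T q. j < i)"
  obtains \<tau> where "bij_betw \<tau> {1..k} {1..k}"
    "\<And>p q i j. \<lbrakk>p \<in> {1..k}; q \<in> {1..k}; p < q; i \<in> T (\<tau> p); j \<in> T (\<tau> q)\<rbrakk> \<Longrightarrow> i < j"
proof -
  \<comment> \<open>Sets are sorted by their minimum. An empty set gets the key
    \<open>n + p\<close>, which exceeds all minima and is different for each \<open>p\<close>, so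
    the keys are distinct.\<close>
  define m where "m p = (if T p = {} then n + p else Min (T p))" for p
  have fin: "finite (T p)" if "p \<in> {1..k}" for p using T[OF that] finite_subset by blast
  have min: "m p \<in> T p" if "p \<in> {1..k}" "T p \<noteq> {}" for p
    using Min_in[OF fin] that by (simp add: m_def)
  have small: "m p \<le> n" if "p \<in> {1..k}" "T p \<noteq> {}" for p
    using min[OF that] T[OF that(1)] by auto
  have inj: "inj_on m {1..k}"
  proof (rule inj_onI)
    fix p q assume pq: "p \<in> {1..k}" "q \<in> {1..k}" and eq: "m p = m q"
    show "p = q"
    proof (cases "T p = {} \<or> T q = {}")
      case True
      with pq eq small[OF pq(1)] small[OF pq(2)] show ?thesis
        by (auto simp: m_def split: if_splits)
    next
      case False
      with min pq have "m p \<in> T p" "m q \<in> T q" by auto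
      with sep[OF pq] eq show ?thesis by force
    qed
  qed
  obtain h where h: "bij_betw h {..<card (m ` {1..k})} (m ` {1..k})"
    and mono: "strict_mono_on {..<card (m ` {1..k})} h"
    by (rule ex_bij_betw_strict_mono_card[of "m ` {1..k}"]) auto
  have card: "card (m ` {1..k}) = k" using card_image[OF inj] by simp
  \<comment> \<open>\<open>h\<close> lists the keys in increasing order from position 0, whereas
    queues are numbered from 1.\<close>
  define \<tau> where "\<tau> p = inv_into {1..k} m (h (p - 1))" for p
  have pred: "bij_betw (\<lambda>p. p - 1) {1..k} {..<k}"
    by (rule bij_betwI[of _ _ _ Suc]) auto
  have bij: "bij_betw \<tau> {1..k} {1..k}"
    using bij_betw_trans[OF bij_betw_trans[OF pred h[unfolded card]]
      bij_betw_inv_into[OF inj_on_imp_bij_betw[OF inj]]]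
    unfolding \<tau>_def o_def .
  have m\<tau>: "m (\<tau> p) = h (p - 1)" if "p \<in> {1..k}" for p
  proof -
    have "p - 1 \<in> {..<card (m ` {1..k})}" using that card by auto
    then have "h (p - 1) \<in> m ` {1..k}" using bij_betwE[OF h] by blast
    then show ?thesis unfolding \<tau>_def by (rule f_inv_into_f)
  qed
  have "i < j" if pq: "p \<in> {1..k}" "q \<in> {1..k}" "p < q" and ij: "i \<in> T (\<tau> p)" "j \<in> T (\<tau> q)" for p q i j
  proof -
    have \<tau>: "\<tau> p \<in> {1..k}" "\<tau> q \<in> {1..k}" using bij_betwE[OF bij] pq by auto
    have "h (p - 1) < h (q - 1)"
      using pq by (intro strict_mono_onD[OF mono[unfolded card]]) auto
    then have less: "m (\<tau> p) < m (\<tau> q)" using m\<tau> pq by simp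
    then have "\<tau> p \<noteq> \<tau> q" by auto
    moreover have "m (\<tau> p) \<in> T (\<tau> p)" "m (\<tau> q) \<in> T (\<tau> q)" using min \<tau> ij by auto
    ultimately show ?thesis using sep[OF \<tau>] less ij by (meson less_asym)
  qed
  with bij that show ?thesis by blast
qed

text \<open>The union of the first \<open>p\<close> sets is downward closed in
  \<open>{1..n}\<close>, hence an initial segment, and \<open>b p\<close> is the first number beyond
  it. An empty set gives equal consecutive thresholds.\<close>

lemma sorted_partition_thresholds:
  fixes T :: "nat \<Rightarrow> nat set"
  assumes cover: "(\<Union>p\<in>{1..k}. T p) = {1..n}"
    and sorted: "\<And>p q i j. \<lbrakk>p \<in> {1..k}; q \<in> {1..k}; p < q; i \<in> T p; j \<in> T q\<rbrakk> \<Longrightarrow> i < j"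
  obtains b where "b 0 = 1" "b k = n + 1" "\<And>p. p \<in> {1..k} \<Longrightarrow> b (p - 1) \<le> b p"
    "\<And>p. p \<in> {1..k} \<Longrightarrow> T p = {b (p - 1)..<b p}"
proof -
  define B where "B p = (\<Union>q\<in>{1..p}. T q)" for p
  define b where "b p = card (B p) + 1" for p
  have sub: "B p \<subseteq> {1..n}" if "p \<le> k" for p using cover that unfolding B_def by force
  have B: "B p = {1..<b p}" if "p \<le> k" for p
  proof -
    have down: "i \<in> B p" if i: "i \<in> {1..n}" "i \<le> j" and j: "j \<in> B p" for i j
    proof -
      obtain q where q: "q \<in> {1..k}" "i \<in> T q" using cover i by blast
      obtain q' where q': "q' \<in> {1..p}" "j \<in> T q'" using j unfolding B_def by blast
      have "\<not> q' < q" using sorted[of q' q j i] q q' \<open>p \<le> k\<close> i by auto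
      with q q' have "q \<in> {1..p}" by auto
      with q show ?thesis unfolding B_def by blast
    qed
    have fin: "finite (B p)" using sub[OF that] finite_subset by blast
    have "B p = {1..card (B p)}"
    proof (cases "B p = {}")
      case False
      have "B p = {1..Max (B p)}"
      proof
        show "B p \<subseteq> {1..Max (B p)}" using sub[OF that] fin by (auto simp: subset_iff)
        have "Max (B p) \<in> B p" using fin False by simp
        then show "{1..Max (B p)} \<subseteq> B p" using down sub[OF that] by fastforce
      qed
      then show ?thesis by (metis card_atLeastAtMost add_diff_cancel_right' One_nat_def Suc_eq_plus1)
    qed simp
    then show ?thesis by (simp add: b_def atLeastLessThanSuc_atLeastAtMost)
  qed
  have mono: "b (p - 1) \<le> b p" if "p \<in> {1..k}" for p
  proof -
    have "finite (B p)" using sub[of p] that finite_subset by auto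
    moreover have "B (p - 1) \<subseteq> B p" unfolding B_def by force
    ultimately show ?thesis unfolding b_def by (simp add: card_mono)
  qed
  have T: "T p = {b (p - 1)..<b p}" if p: "p \<in> {1..k}" for p
  proof -
    have "{1..p} = insert p {1..p - 1}" using p by auto
    then have "B p = B (p - 1) \<union> T p" unfolding B_def by auto
    moreover have "B (p - 1) \<inter> T p = {}"
    proof -
      have "i \<notin> T p" if "i \<in> T q" "q \<in> {1..p - 1}" for i q
      proof -
        have "q \<in> {1..k}" "q < p" using that p by auto
        then show ?thesis using sorted[of q p i i] that p by blast
      qed
      then show ?thesis unfolding B_def by blast
    qed
    ultimately have "T p = B p - B (p - 1)" by blast
    also have "\<dots> = {1..<b p} - {1..<b (p - 1)}" using B[of p] B[of "p - 1"] p by auto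
    also have "\<dots> = {b (p - 1)..<b p}" by (auto simp: b_def)
    finally show ?thesis .
  qed
  have "b 0 = 1" by (simp add: b_def B_def)
  moreover have "b k = n + 1" using cover by (simp add: b_def B_def)
  ultimately show ?thesis using mono T that by blast
qed

section \<open>Renumbering the queues and reading off the thresholds\<close>

context partition_problem
begin

lemma optimal_partition_permute:
  assumes opt: "optimal_partition n k lam \<mu> v X \<alpha>" and \<tau>: "bij_betw \<tau> {1..k} {1..k}"
  shows "optimal_partition n k lam \<mu> v (\<lambda>i j. X i (\<tau> j)) (\<lambda>j. \<alpha> (\<tau> j))"
proof -
  interpret optimal_partition n k lam \<mu> v X \<alpha> by (rule opt)
  let ?Y = "\<lambda>i j. X i (\<tau> j)" and ?\<beta> = "\<lambda>j. \<alpha> (\<tau> j)"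
  have eq: "load ?Y j = load X (\<tau> j)" "cost ?Y ?\<beta> j = cost X \<alpha> (\<tau> j)" "stable ?Y ?\<beta> j = stable X \<alpha> (\<tau> j)" for j
    by (simp_all add: load_def moment_def arrivals_def slack_def cost_def stable_def)
  have sum: "(\<Sum>j=1..k. g (\<tau> j)) = (\<Sum>j=1..k. g j)" for g :: "nat \<Rightarrow> real"
    using \<tau> by (rule sum.reindex_bij_betw)
  have "total_cost ?Y ?\<beta> = total_cost X \<alpha>"
    unfolding total_cost_def eq by (rule sum)
  moreover have "(?Y, ?\<beta>) \<in> qpp_feasible n k lam \<mu>"
    using feasible bij_betwE[OF \<tau>] unfolding feasible_iff eq sum by blast
  ultimately show ?thesis
    using optimal by unfold_locales simp_all
qed

lemma optimal_partition_imp_qpp_optimal: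
  assumes "optimal_partition n k lam \<mu> v X \<alpha>"
  shows "qpp_optimal n k lam \<mu> v (X, \<alpha>)"
proof -
  interpret optimal_partition n k lam \<mu> v X \<alpha> by (rule assms)
  have wait: "expected_wait n k lam \<mu> v (Y, \<beta>) = total_cost Y \<beta> / (2 * (\<Sum>i=1..n. lam i))"
    if "(Y, \<beta>) \<in> qpp_feasible n k lam \<mu>" for Y \<beta>
    using expected_wait_eq that by (simp add: feasible_iff)
  \<comment> \<open>Nonnegativity suffices: for \<open>n = 0\<close> both waiting times are
    0.\<close>
  have "0 \<le> (\<Sum>i=1..n. lam i)" using lam_pos by (intro sum_nonneg) (simp add: less_imp_le)
  then have "expected_wait n k lam \<mu> v (X, \<alpha>) \<le> expected_wait n k lam \<mu> v (Y, \<beta>)"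
    if "(Y, \<beta>) \<in> qpp_feasible n k lam \<mu>" for Y \<beta>
    unfolding wait[OF feasible] wait[OF that] using optimal[OF that] by (intro divide_right_mono) simp_all
  then show ?thesis
    unfolding qpp_optimal_def is_arg_min_linorder using feasible by auto
qed

lemma exists_threshold_optimum:
  assumes "qpp_feasible n k lam \<mu> \<noteq> {}"
  shows "\<exists>X \<alpha> (b :: nat \<Rightarrow> nat).
           qpp_optimal n k lam \<mu> v (X, \<alpha>) \<and>
           b 0 = 1 \<and> b k = n + 1 \<and> (\<forall>j\<in>{1..k}. b (j - 1) \<le> b j) \<and>
           (\<forall>i\<in>{1..n}. \<forall>j\<in>{1..k}. X i j = (if b (j - 1) \<le> i \<and> i < b j then 1 else 0))"
proof -
  obtain X\<^sub>0 \<alpha>\<^sub>0 where opt0: "optimal_partition n k lam \<mu> v X\<^sub>0 \<alpha>\<^sub>0"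
    using exists_minimizer[OF assms] .
  obtain \<tau> where \<tau>: "bij_betw \<tau> {1..k} {1..k}"
    and sorted0: "\<And>p q i j. \<lbrakk>p \<in> {1..k}; q \<in> {1..k}; p < q; i \<in> types X\<^sub>0 (\<tau> p); j \<in> types X\<^sub>0 (\<tau> q)\<rbrakk> \<Longrightarrow> i < j"
    using optimal_partition.types_separated[OF opt0]
    by (rule separated_sets_sortable[of k "types X\<^sub>0" n, rotated]) (auto simp: types_def)
  define X \<alpha> where "X = (\<lambda>i j. X\<^sub>0 i (\<tau> j))" and "\<alpha> = (\<lambda>j. \<alpha>\<^sub>0 (\<tau> j))"
  interpret optimal_partition n k lam \<mu> v X \<alpha>
    unfolding X_def \<alpha>_def by (rule optimal_partition_permute[OF opt0 \<tau>])
  have sorted: "i < j" if "p \<in> {1..k}" "q \<in> {1..k}" "p < q" "i \<in> types X p" "j \<in> types X q" for p q i j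
    using sorted0[OF that(1-3)] that(4,5) by (simp add: types_def X_def)
  have rows: "(\<Sum>j=1..k. X i j) = 1" if "i \<in> {1..n}" for i
    using feasible that by (simp add: feasible_iff)
  \<comment> \<open>A type in two queues would satisfy \<open>i < i\<close>. So each row has a
    single nonzero entry, which the row sum makes equal to 1.\<close>
  have alone: "X i q = 0" if i: "i \<in> types X p" and pq: "p \<in> {1..k}" "q \<in> {1..k}" "p \<noteq> q" for i p q
  proof (rule ccontr)
    assume "X i q \<noteq> 0"
    then have "i \<in> types X q" using X_nonneg[of i q] i pq by (simp add: types_def less_le)
    then show False using sorted[of p q i i] sorted[of q p i i] i pq by (meson less_irrefl nat_neq_iff)
  qed
  have X_eq: "X i j = (if i \<in> types X j then 1 else 0)" if i: "i \<in> {1..n}" and j: "j \<in> {1..k}" for i j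
  proof (cases "i \<in> types X j")
    case True
    have "(\<Sum>q=1..k. X i q) = X i j"
      using alone[OF True j] j by (subst sum.remove[of _ j]) auto
    with rows[OF i] True show ?thesis by simp
  next
    case False
    with X_nonneg[OF i j] i show ?thesis by (simp add: types_def)
  qed
  have cover: "(\<Union>p\<in>{1..k}. types X p) = {1..n}"
  proof
    show "{1..n} \<subseteq> (\<Union>p\<in>{1..k}. types X p)"
    proof
      fix i assume i: "i \<in> {1..n}"
      have "\<exists>p\<in>{1..k}. X i p \<noteq> 0"
        using rows[OF i] by (metis sum.neutral zero_neq_one)
      then show "i \<in> (\<Union>p\<in>{1..k}. types X p)"
        using i X_nonneg[OF i] by (auto simp: types_def less_le)
    qed
  qed (auto simp: types_def)
  obtain b where b: "b 0 = 1" "b k = n + 1" "\<And>p. p \<in> {1..k} \<Longrightarrow> b (p - 1) \<le> b p"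
    "\<And>p. p \<in> {1..k} \<Longrightarrow> types X p = {b (p - 1)..<b p}"
  proof (rule sorted_partition_thresholds[OF cover])
    fix p q i j
    assume "p \<in> {1..k}" "q \<in> {1..k}" "p < q" "i \<in> types X p" "j \<in> types X q"
    then show "i < j" by (rule sorted)
  qed (rule that)
  have "\<forall>i\<in>{1..n}. \<forall>j\<in>{1..k}. X i j = (if b (j - 1) \<le> i \<and> i < b j then 1 else 0)"
    using X_eq b(4) by simp
  with b(1-3) optimal_partition_imp_qpp_optimal[OF optimal_partition_axioms] show ?thesis by blast
qed

end

section \<open>From random service times to their moments\<close>

theorem theorem6:
  fixes n k :: nat
    and lam \<mu> v :: "nat \<Rightarrow> real"
    and M :: "'a measure"
    and S :: "nat \<Rightarrow> 'a \<Rightarrow> real"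
  assumes lam_pos: "\<And>i. i \<in> {1..n} \<Longrightarrow> lam i > 0"
    and mu_pos: "\<And>i. i \<in> {1..n} \<Longrightarrow> \<mu> i > 0"
    and mu_decreasing: "\<And>i j. \<lbrakk>i \<in> {1..n}; j \<in> {1..n}; i < j\<rbrakk> \<Longrightarrow> \<mu> i > \<mu> j"
    and prob: "prob_space M"
    and S_rv: "\<And>i. i \<in> {1..n} \<Longrightarrow> S i \<in> borel_measurable M"
    and S_nonneg: "\<And>i. i \<in> {1..n} \<Longrightarrow> AE \<omega> in M. 0 \<le> S i \<omega>"
    and S_integrable: "\<And>i. i \<in> {1..n} \<Longrightarrow> integrable M (S i)"
    and S_mean: "\<And>i. i \<in> {1..n} \<Longrightarrow> prob_space.expectation M (S i) = 1 / \<mu> i"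
    and S_sq_integrable: "\<And>i. i \<in> {1..n} \<Longrightarrow> integrable M (\<lambda>\<omega>. (S i \<omega>)\<^sup>2)"
    and S_second_moment:
      "\<And>i. i \<in> {1..n} \<Longrightarrow> prob_space.expectation M (\<lambda>\<omega>. (S i \<omega>)\<^sup>2) = v i"
    and ratio_monotone:
      "\<And>i j. \<lbrakk>i \<in> {1..n}; j \<in> {1..n};
              prob_space.expectation M (S i) \<ge> prob_space.expectation M (S j)\<rbrakk>
        \<Longrightarrow> prob_space.expectation M (\<lambda>\<omega>. (S i \<omega>)\<^sup>2) / prob_space.expectation M (S i)
            \<ge> prob_space.expectation M (\<lambda>\<omega>. (S j \<omega>)\<^sup>2) / prob_space.expectation M (S j)"
    and feasible: "qpp_feasible n k lam \<mu> \<noteq> {}"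
  shows "\<exists>X \<alpha> (b :: nat \<Rightarrow> nat).
           qpp_optimal n k lam \<mu> v (X, \<alpha>) \<and>
           b 0 = 1 \<and> b k = n + 1 \<and> (\<forall>j\<in>{1..k}. b (j - 1) \<le> b j) \<and>
           (\<forall>i\<in>{1..n}. \<forall>j\<in>{1..k}.
              X i j = (if b (j - 1) \<le> i \<and> i < b j then 1 else 0))"
proof -
  interpret prob_space M by (rule prob)
  \<comment> \<open>The variance is nonnegative, so the second moment is at least the square of the
    positive mean.\<close>
  have "v i > 0" if i: "i \<in> {1..n}" for i
  proof -
    have "0 \<le> variance (S i)" by (rule variance_positive)
    also have "\<dots> = v i - (1 / \<mu> i)\<^sup>2"
      using variance_eq[OF S_integrable[OF i] S_sq_integrable[OF i]] S_mean[OF i] S_second_moment[OF i] by simp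
    finally have "(1 / \<mu> i)\<^sup>2 \<le> v i" by simp
    moreover have "0 < (1 / \<mu> i)\<^sup>2" using mu_pos[OF i] by simp
    ultimately show ?thesis by linarith
  qed
  \<comment> \<open>Means \<open>1 / \<mu> i\<close> increase with the index, so
    \<open>ratio_monotone\<close> applies to ordered indices.\<close>
  moreover have "v i * \<mu> i \<le> v j * \<mu> j" if "i \<in> {1..n}" "j \<in> {1..n}" "i \<le> j" for i j
  proof -
    have "\<mu> j \<le> \<mu> i" using mu_decreasing[OF that(1,2)] that(3) by (cases "i = j") auto
    then have "expectation (S i) \<le> expectation (S j)"
      using S_mean that mu_pos[OF that(2)] by (simp add: frac_le)
    from ratio_monotone[OF that(2,1) this] show ?thesis
      using S_mean S_second_moment that by simp
  qed
  ultimately interpret partition_problem n k lam \<mu> v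
    using lam_pos mu_pos mu_decreasing by unfold_locales
  show ?thesis by (rule exists_threshold_optimum[OF feasible])
qed

end
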